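(* Let $M_1,M_2$ be matroids on the same ground set with $n$ elements, and let $I_k$ denote the number of common independent sets of $M_1$ and $M_2$ of size $k$ (i.e. sets of size $k$ that are independent in both $M_1$ and $M_2$). Then for every integer $k$ with $0\leq k\leq n-2$, $$\frac{I_k}{\binom{n}{k}}\cdot \frac{I_{k+2}}{\binom{n}{k+2}}\leq \left(\frac{I_{k+1}}{\binom{n}{k+1}}\right)^2.$$
   Context: Matroids are finite matroids in the usual sense. *)

theory Defs
  imports Complex_Main
begin

locale matroid =
  fixes carrier :: "'a set" and indep :: "'a set \<Rightarrow> bool"
  assumes carrier_finite: "finite carrier"
    and indep_subset_carrier: "indep X \<Longrightarrow> X \<subseteq> carrier"
    and indep_empty: "indep {}"
    and indep_subset: "indep X \<Longrightarrow> Y \<subseteq> X \<Longrightarrow> indep Y"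
    and augment: "indep X \<Longrightarrow> indep Y \<Longrightarrow> card Y < card X \<Longrightarrow> \<exists>x\<in>X - Y. indep (insert x Y)"

definition common_indep_count :: "('a set \<Rightarrow> bool) \<Rightarrow> ('a set \<Rightarrow> bool) \<Rightarrow> nat \<Rightarrow> nat" where
  "common_indep_count indep1 indep2 k = card {X. indep1 X \<and> indep2 X \<and> card X = k}"

end

theory Submission
  imports Defs "HOL-Analysis.Function_Topology" "HOL-Analysis.Convex" "HOL-Library.Multiset"
begin

text \<open>
  For \<open>0 < q \<le> 1\<close> and \<open>p = 1 / q\<close> the random cluster polynomials
  \<open>f = \<Sum>A. p ^ r1 A * x\<^sup>A * w ^ (n - card A)\<close> and
  \<open>g = \<Sum>B. p ^ s2 B * y\<^sup>B * z ^ (n - card B)\<close>, with \<open>r1\<close> the rank function of \<open>M1\<close> and \<open>s2\<close>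
  that of the dual of \<open>M2\<close>, have second-order derivatives with at most one positive eigenvalue, and
  so has their product, in disjoint variables. A local-to-global argument extends this to iterated
  derivatives of \<open>f * g\<close> along positive vectors, which is the Alexandrov--Fenchel inequality for the
  polar form of \<open>f * g\<close>. Differentiating \<open>f * g\<close> along \<open>x\<^sub>e + y\<^sub>e\<close> for every \<open>e\<close> leaves only the pairs
  \<open>B = E - A\<close>; the resulting form in \<open>w\<close> and \<open>z\<close> has, up to a geometric factor, the
  coefficients \<open>\<Sum>A. q ^ ((k - r1 A) + (k - r2 A))\<close> over the sets \<open>A\<close> of size \<open>k\<close>, and these
  tend to \<open>I\<^sub>k\<close> as \<open>q\<close> tends to 0.
\<close>

section \<open>Hyperbolic quadratic forms\<close>

definition bform :: "'b set \<Rightarrow> ('b \<Rightarrow> 'b \<Rightarrow> real) \<Rightarrow> ('b \<Rightarrow> real) \<Rightarrow> ('b \<Rightarrow> real) \<Rightarrow> real" where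
  "bform V H x y = (\<Sum>i\<in>V. \<Sum>j\<in>V. H i j * x i * y j)"

text \<open>At most one positive eigenvalue, expressed without eigenvalues: the form is nonpositive
  on the kernel of some linear functional. The choice \<open>l = 0\<close> covers forms that are
  nonpositive everywhere.\<close>

definition hyperbolic :: "'b set \<Rightarrow> ('b \<Rightarrow> 'b \<Rightarrow> real) \<Rightarrow> bool" where
  "hyperbolic V H \<longleftrightarrow> (\<exists>l. \<forall>z. (\<Sum>i\<in>V. l i * z i) = 0 \<longrightarrow> bform V H z z \<le> 0)"

lemma bform_cong:
  assumes "\<And>i j. i \<in> V \<Longrightarrow> j \<in> V \<Longrightarrow> H i j = H' i j"
    and "\<And>i. i \<in> V \<Longrightarrow> x i = x' i" "\<And>i. i \<in> V \<Longrightarrow> y i = y' i"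
  shows "bform V H x y = bform V H' x' y'"
  unfolding bform_def using assms by (intro sum.cong refl) auto

lemma bform_commute:
  assumes "\<And>i j. i \<in> V \<Longrightarrow> j \<in> V \<Longrightarrow> H i j = H j i"
  shows "bform V H x y = bform V H y x"
proof -
  have "bform V H x y = (\<Sum>j\<in>V. \<Sum>i\<in>V. H i j * x i * y j)"
    unfolding bform_def by (rule sum.swap)
  also have "\<dots> = bform V H y x"
    unfolding bform_def using assms by (intro sum.cong refl) auto
  finally show ?thesis .
qed

lemma bform_row: "bform V H x y = (\<Sum>i\<in>V. x i * (\<Sum>j\<in>V. H i j * y j))"
  unfolding bform_def by (simp add: sum_distrib_left mult_ac)

lemma bform_add_scaled:
  assumes "\<And>i j. i \<in> V \<Longrightarrow> j \<in> V \<Longrightarrow> H i j = H j i"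
  shows "bform V H (\<lambda>i. x i + r * y i) (\<lambda>i. x i + r * y i)
    = bform V H x x + 2 * r * bform V H x y + r\<^sup>2 * bform V H y y"
proof -
  have "bform V H (\<lambda>i. x i + r * y i) (\<lambda>i. x i + r * y i)
    = bform V H x x + r * bform V H x y + r * bform V H y x + r\<^sup>2 * bform V H y y"
    unfolding bform_def sum_distrib_left sum.distrib[symmetric]
    by (intro sum.cong refl) (simp add: algebra_simps power2_eq_square)
  then show ?thesis using bform_commute[of V H x y] assms by simp
qed

text \<open>If the form is positive at \<open>y\<close>, then \<open>y\<close> lies off the kernel
  of \<open>l\<close>, so \<open>z\<close> can be moved along \<open>y\<close> into that kernel.
  Nonpositivity there is the claimed discriminant inequality.\<close>

lemma hyperbolic_reverse_Cauchy:
  assumes hyp: "hyperbolic V H"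
    and sym: "\<And>i j. i \<in> V \<Longrightarrow> j \<in> V \<Longrightarrow> H i j = H j i"
    and nonneg: "0 \<le> bform V H y y"
  shows "bform V H y y * bform V H z z \<le> (bform V H y z)\<^sup>2"
proof (cases "bform V H y y = 0")
  case True
  then show ?thesis by simp
next
  case False
  with nonneg have pos: "bform V H y y > 0" by simp
  from hyp obtain l where l: "\<And>z. (\<Sum>i\<in>V. l i * z i) = 0 \<Longrightarrow> bform V H z z \<le> 0"
    unfolding hyperbolic_def by blast
  define L where "L z = (\<Sum>i\<in>V. l i * z i)" for z
  have Ly: "L y \<noteq> 0" using l[of y] pos unfolding L_def by auto
  \<comment> \<open>This value places \<open>z + r * y\<close> in the kernel of
    \<open>L\<close>.\<close>
  define r where "r = - L z / L y"
  have "L (\<lambda>i. z i + r * y i) = L z + r * L y"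
    unfolding L_def by (simp add: sum.distrib sum_distrib_left algebra_simps)
  also have "\<dots> = 0" using Ly by (simp add: r_def)
  finally have "bform V H (\<lambda>i. z i + r * y i) (\<lambda>i. z i + r * y i) \<le> 0"
    using l[of "\<lambda>i. z i + r * y i"] unfolding L_def by simp
  then have q: "bform V H z z + 2 * r * bform V H y z + r\<^sup>2 * bform V H y y \<le> 0"
    using bform_add_scaled[of V H z r y] bform_commute[of V H y z] sym by simp
  \<comment> \<open>Multiply the kernel inequality by the positive value at \<open>y\<close> and
    complete the square.\<close>
  have "bform V H y y * bform V H z z
      \<le> bform V H y y * (- 2 * r * bform V H y z - r\<^sup>2 * bform V H y y)"
    using q pos by (intro mult_left_mono) auto
  also have "\<dots> = (bform V H y z)\<^sup>2 - (bform V H y z + r * bform V H y y)\<^sup>2"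
    by (simp add: power2_eq_square algebra_simps)
  also have "\<dots> \<le> (bform V H y z)\<^sup>2" by simp
  finally show ?thesis .
qed

section \<open>Spectrum of a reversible Markov kernel\<close>

text \<open>First-order condition at a maximum: for small \<open>r\<close> the linear term would
  dominate. It replaces differentiation of the Rayleigh quotient.\<close>

lemma linear_le_quadratic_imp_nonpos:
  fixes g c :: real
  assumes "\<And>r. 2 * r * g \<le> r\<^sup>2 * c" "c \<ge> 0"
  shows "g \<le> 0"
proof (rule ccontr)
  assume "\<not> g \<le> 0"
  then have g: "g > 0" by simp
  \<comment> \<open>The denominator \<open>c + 1\<close> keeps the witness defined when
    \<open>c = 0\<close>.\<close>
  define r where "r = g / (c + 1)"
  have r: "r > 0" "g = r * (c + 1)" using g assms(2) by (auto simp: r_def)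
  have "2 * r * g \<le> r * r * c" using assms(1)[of r] by (simp add: power2_eq_square)
  then have "r * (r * (2 * (c + 1))) \<le> r * (r * c)" by (simp add: r(2) algebra_simps)
  then have "2 * (c + 1) \<le> c" using r(1) by simp
  then show False using assms(2) by simp
qed

text \<open>Supplies the domain on which a Rayleigh quotient attains its maximum. Functions are
  forced to 0 off \<open>U\<close>, so the set is a closed part of a product of compact
  intervals.\<close>

lemma compact_weighted_sphere:
  fixes p :: "'b \<Rightarrow> real"
  assumes fin: "finite U" and p: "\<And>i. i \<in> U \<Longrightarrow> p i > 0"
  shows "compact {s. (\<forall>i. i \<notin> U \<longrightarrow> s i = 0) \<and> (\<Sum>i\<in>U. p i * (s i)\<^sup>2) = 1
                     \<and> (\<Sum>i\<in>U. p i * s i) = 0}" (is "compact ?S")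
proof -
  \<comment> \<open>The unit norm bounds \<open>s i\<close> by \<open>1 / sqrt (p i)\<close>; the
    larger bound \<open>1 + 1 / p i\<close> avoids the root.\<close>
  define X where "X i = (if i \<in> U then {- (1 + 1 / p i) .. 1 + 1 / p i} else {0})" for i
  have "compactin (product_topology (\<lambda>i. euclidean) UNIV) (PiE UNIV X)"
    unfolding compactin_PiE by (auto simp: X_def compactin_euclidean_iff)
  then have c: "compact (PiE UNIV X)"
    by (simp flip: euclidean_product_topology compactin_euclidean_iff)
  have "closed {s. (\<Sum>i\<in>U. p i * (s i)\<^sup>2) = 1}"
    by (intro closed_Collect_eq continuous_intros continuous_on_product_coordinates)
  moreover have "closed {s. (\<Sum>i\<in>U. p i * s i) = 0}"
    by (intro closed_Collect_eq continuous_intros continuous_on_product_coordinates)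
  ultimately have cl: "closed ({s. (\<Sum>i\<in>U. p i * (s i)\<^sup>2) = 1} \<inter> {s. (\<Sum>i\<in>U. p i * s i) = 0})"
    by (rule closed_Int)
  have bound: "\<bar>s i\<bar> \<le> 1 + 1 / p i" if "s \<in> ?S" "i \<in> U" for s i
  proof -
    have "p i * (s i)\<^sup>2 \<le> (\<Sum>i\<in>U. p i * (s i)\<^sup>2)"
      using p fin that by (intro member_le_sum) (auto intro!: mult_nonneg_nonneg less_imp_le[OF p])
    then have "p i * (s i)\<^sup>2 \<le> 1" using that by simp
    then have "(s i)\<^sup>2 \<le> 1 / p i" using p[OF that(2)] by (simp add: field_simps)
    also have "\<dots> \<le> (1 + 1 / p i)\<^sup>2"
      using p[OF that(2)] by (simp add: power2_eq_square field_simps)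
    finally show ?thesis using p[OF that(2)] by (simp add: abs_le_square_iff[symmetric])
  qed
  have "?S = PiE UNIV X \<inter> ({s. (\<Sum>i\<in>U. p i * (s i)\<^sup>2) = 1} \<inter> {s. (\<Sum>i\<in>U. p i * s i) = 0})"
    (is "_ = ?T")
  proof (intro set_eqI iffI)
    fix s assume s: "s \<in> ?S"
    have "s i \<in> X i" for i
      using s bound[OF s, of i] by (auto simp: X_def)
    then show "s \<in> ?T" using s by auto
  next
    fix s assume s: "s \<in> ?T"
    have "s i = 0" if "i \<notin> U" for i
    proof -
      have "s i \<in> X i" using s by (auto simp: PiE_def Pi_def)
      then show ?thesis using that by (simp add: X_def)
    qed
    then show "s \<in> ?S" using s by auto
  qed
  then show ?thesis using c cl by (simp add: compact_Int_closed)
qed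

text \<open>
  \<open>P i j = K i j / \<pi> i\<close> is a reversible Markov kernel, and \<open>improve\<close> says \<open>P \<le> P\<^sup>2\<close> as
  quadratic forms. So no eigenvalue of \<open>P\<close> lies in \<open>{0<..<1}\<close>; the hub makes the chain
  irreducible, so that the eigenvalue 1 is simple.
\<close>
lemma Markov_nonpos_on_mean_zero:
  fixes K :: "'b \<Rightarrow> 'b \<Rightarrow> real"
    and U :: "'b set"
  defines "\<pi> \<equiv> \<lambda>i. \<Sum>j\<in>U. K i j"
  assumes fin: "finite U"
    and sym: "\<And>i j. i \<in> U \<Longrightarrow> j \<in> U \<Longrightarrow> K i j = K j i"
    and nonneg: "\<And>i j. i \<in> U \<Longrightarrow> j \<in> U \<Longrightarrow> K i j \<ge> 0"
    and hub: "h \<in> U" "\<And>i. i \<in> U \<Longrightarrow> K i h > 0"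
    and improve: "\<And>t. bform U K t t \<le> (\<Sum>i\<in>U. (\<Sum>j\<in>U. K i j * t j)\<^sup>2 / \<pi> i)"
    and mean0: "(\<Sum>i\<in>U. \<pi> i * t i) = 0"
  shows "bform U K t t \<le> 0"
proof (rule ccontr)
  assume "\<not> ?thesis"
  then have tpos: "bform U K t t > 0" by simp
  have \<pi>: "\<pi> i > 0" if "i \<in> U" for i
    unfolding \<pi>_def using hub that nonneg fin by (intro sum_pos2[of U h]) auto
  define N where "N s = (\<Sum>i\<in>U. \<pi> i * (s i)\<^sup>2)" for s
  have N0: "N s \<ge> 0" for s
    unfolding N_def using \<pi> by (intro sum_nonneg mult_nonneg_nonneg) (auto intro: less_imp_le)
  have N_zero: "s i = 0" if "N s \<le> 0" "i \<in> U" for s i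
  proof -
    have "N s = 0" using N0[of s] that by simp
    then have "\<pi> i * (s i)\<^sup>2 = 0"
      unfolding N_def using sum_nonneg_eq_0_iff[OF fin, of "\<lambda>i. \<pi> i * (s i)\<^sup>2"] \<pi> that
      by (auto simp: less_imp_le)
    then show ?thesis using \<pi>[OF that(2)] by simp
  qed
  define S where "S = {s. (\<forall>i. i \<notin> U \<longrightarrow> s i = 0) \<and> N s = 1 \<and> (\<Sum>i\<in>U. \<pi> i * s i) = 0}"
  have compS: "compact S"
    unfolding S_def N_def using compact_weighted_sphere[OF fin \<pi>] by simp
  define nrm where "nrm u = (\<lambda>i. if i \<in> U then u i / sqrt (N u) else 0)" for u
  have nrm: "nrm u \<in> S" "bform U K (nrm u) (nrm u) = bform U K u u / N u"
    if "N u > 0" "(\<Sum>i\<in>U. \<pi> i * u i) = 0" for u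
  proof -
    have "N (nrm u) = (\<Sum>i\<in>U. \<pi> i * (u i)\<^sup>2 / N u)"
      unfolding N_def[of "nrm u"] using that
      by (intro sum.cong refl) (simp add: nrm_def power_divide)
    also have "\<dots> = 1" unfolding sum_divide_distrib[symmetric] N_def[symmetric] using that by simp
    finally have "N (nrm u) = 1" .
    moreover have "(\<Sum>i\<in>U. \<pi> i * nrm u i) = (\<Sum>i\<in>U. \<pi> i * u i) / sqrt (N u)"
      unfolding nrm_def sum_divide_distrib by (intro sum.cong refl) simp
    ultimately show "nrm u \<in> S" unfolding S_def using that by (simp add: nrm_def)
    have "bform U K (nrm u) (nrm u)
        = (\<Sum>i\<in>U. \<Sum>j\<in>U. K i j * u i * u j / (sqrt (N u) * sqrt (N u)))"
      unfolding bform_def nrm_def by (intro sum.cong refl) simp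
    also have "\<dots> = bform U K u u / N u"
      unfolding bform_def using that by (simp add: sum_divide_distrib)
    finally show "bform U K (nrm u) (nrm u) = bform U K u u / N u" .
  qed
  have Nt: "N t > 0"
  proof (rule ccontr)
    assume "\<not> N t > 0"
    then have "t i = 0" if "i \<in> U" for i using N_zero that by auto
    then have "bform U K t t = 0" unfolding bform_def by simp
    then show False using tpos by simp
  qed
  have "continuous_on UNIV (\<lambda>s. bform U K s s)"
    unfolding bform_def
    by (intro continuous_on_sum continuous_on_mult continuous_on_const
          continuous_on_product_coordinates)
  then have "continuous_on S (\<lambda>s. bform U K s s)" by (rule continuous_on_subset) simp
  moreover have "S \<noteq> {}" using nrm(1)[OF Nt mean0] by auto
  ultimately obtain s where sS: "s \<in> S"
    and smax: "\<And>u. u \<in> S \<Longrightarrow> bform U K u u \<le> bform U K s s"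
    using continuous_attains_sup[OF compS, of "\<lambda>s. bform U K s s"] by blast
  \<comment> \<open>The largest eigenvalue of \<open>P\<close> on mean-zero functions, attained at
    the unit vector \<open>s\<close>. It is positive by the assumption to be refuted.\<close>
  define lam where "lam = bform U K s s"
  have Ns: "N s = 1" and smean: "(\<Sum>i\<in>U. \<pi> i * s i) = 0" using sS by (auto simp: S_def)
  have "lam \<ge> bform U K t t / N t"
    using smax[OF nrm(1)[OF Nt mean0]] nrm(2)[OF Nt mean0] by (simp add: lam_def)
  then have lam: "lam > 0" using tpos Nt by (meson divide_pos_pos less_le_trans)
  have rayleigh: "bform U K u u \<le> lam * N u" if "(\<Sum>i\<in>U. \<pi> i * u i) = 0" for u
  proof (cases "N u > 0")
    case True
    then show ?thesis
      using smax[OF nrm(1)[OF True that]] nrm(2)[OF True that] by (simp add: lam_def field_simps)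
  next
    case False
    then have "u i = 0" if "i \<in> U" for i using N_zero that by auto
    then have "bform U K u u = 0" unfolding bform_def by simp
    then show ?thesis using lam N0[of u] by simp
  qed
  define As where "As i = (\<Sum>j\<in>U. K i j * s j)" for i
  \<comment> \<open>The residual \<open>P s - lam * s\<close>: half the gradient of
    \<open>bform - lam * N\<close> at \<open>s\<close> in the \<open>\<pi>\<close>-weighted inner
    product. Showing \<open>e = 0\<close> makes \<open>s\<close> an eigenvector.\<close>
  define e where "e i = As i / \<pi> i - lam * s i" for i
  have \<pi>e: "\<pi> i * e i = As i - lam * (\<pi> i * s i)" if "i \<in> U" for i
    using \<pi>[OF that] by (simp add: e_def field_simps)
  have "(\<Sum>i\<in>U. As i) = (\<Sum>j\<in>U. \<Sum>i\<in>U. K i j * s j)"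
    unfolding As_def by (rule sum.swap)
  also have "\<dots> = (\<Sum>j\<in>U. \<pi> j * s j)"
    unfolding \<pi>_def sum_distrib_right using sym by (intro sum.cong refl) auto
  finally have sumAs: "(\<Sum>i\<in>U. As i) = 0" using smean by simp
  have emean: "(\<Sum>i\<in>U. \<pi> i * e i) = 0"
  proof -
    have "(\<Sum>i\<in>U. \<pi> i * e i) = (\<Sum>i\<in>U. As i - lam * (\<pi> i * s i))"
      using \<pi>e by (intro sum.cong refl) auto
    also have "\<dots> = 0" using sumAs smean by (simp add: sum_subtractf flip: sum_distrib_left)
    finally show ?thesis .
  qed
  have first: "bform U K s e - lam * (\<Sum>i\<in>U. \<pi> i * s i * e i) = N e"
  proof -
    have "bform U K s e = (\<Sum>i\<in>U. As i * e i)"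
      using bform_commute[of U K s e] sym by (simp add: bform_row As_def mult_ac)
    then have "bform U K s e - lam * (\<Sum>i\<in>U. \<pi> i * s i * e i)
        = (\<Sum>i\<in>U. (As i - lam * (\<pi> i * s i)) * e i)"
      by (simp add: algebra_simps sum_subtractf sum_distrib_left)
    also have "\<dots> = N e"
      unfolding N_def power2_eq_square by (intro sum.cong refl) (simp flip: \<pi>e)
    finally show ?thesis .
  qed
  \<comment> \<open>Since \<open>e\<close> has mean zero, \<open>s + r * e\<close> obeys the
    Rayleigh bound for every \<open>r\<close>. The linear term in \<open>r\<close> is
    \<open>2 * r * N e\<close>, and it must not be positive.\<close>
  have "N e \<le> 0"
  proof (rule linear_le_quadratic_imp_nonpos)
    show "0 \<le> lam * N e - bform U K e e" using rayleigh[OF emean] by simp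
    fix r :: real
    have "(\<Sum>i\<in>U. \<pi> i * (s i + r * e i)) = 0"
      using smean emean
      by (simp add: distrib_left sum.distrib mult.left_commute[of _ r] flip: sum_distrib_left)
    from rayleigh[OF this]
    have "bform U K s s + 2 * r * bform U K s e + r\<^sup>2 * bform U K e e
        \<le> lam * N (\<lambda>i. s i + r * e i)"
      using bform_add_scaled[of U K s r e] sym by simp
    also have "N (\<lambda>i. s i + r * e i) = N s + 2 * r * (\<Sum>i\<in>U. \<pi> i * s i * e i) + r\<^sup>2 * N e"
      unfolding N_def
      by (simp add: power2_eq_square algebra_simps sum.distrib sum_distrib_left)
    finally show "2 * r * N e \<le> r\<^sup>2 * (lam * N e - bform U K e e)"
      using Ns unfolding first[symmetric] by (simp add: lam_def algebra_simps)
  qed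
  then have eig: "As i = lam * (\<pi> i * s i)" if "i \<in> U" for i
    using N_zero[of e i] \<pi>e[OF that] that by simp
  \<comment> \<open>On the eigenvector, \<open>P \<le> P\<^sup>2\<close> reads
    \<open>lam \<le> lam\<^sup>2\<close>, which excludes values strictly between 0 and 1.\<close>
  have "lam \<le> (\<Sum>i\<in>U. (As i)\<^sup>2 / \<pi> i)"
    using improve[of s] by (simp add: lam_def As_def)
  also have "\<dots> = (\<Sum>i\<in>U. lam\<^sup>2 * (\<pi> i * (s i)\<^sup>2))"
  proof (intro sum.cong refl)
    fix i assume "i \<in> U"
    then show "(As i)\<^sup>2 / \<pi> i = lam\<^sup>2 * (\<pi> i * (s i)\<^sup>2)"
      using \<pi>[of i] eig[of i] by (simp add: power2_eq_square)
  qed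
  also have "\<dots> = lam\<^sup>2" using Ns by (simp add: N_def flip: sum_distrib_left)
  finally have lam1: "lam \<ge> 1" using lam by (simp add: power2_eq_square)
  \<comment> \<open>This Dirichlet form equals \<open>2 * (1 - lam)\<close>, hence is at most 0.
    Every \<open>i\<close> is joined to the hub with positive weight, so \<open>s\<close> is
    constant; mean zero then forces \<open>s = 0\<close>, against \<open>N s = 1\<close>.\<close>
  have "(\<Sum>i\<in>U. \<Sum>j\<in>U. K i j * (s i - s j)\<^sup>2)
      = (\<Sum>i\<in>U. \<Sum>j\<in>U. K i j * (s i)\<^sup>2) + (\<Sum>i\<in>U. \<Sum>j\<in>U. K i j * (s j)\<^sup>2)
        - 2 * bform U K s s"
    unfolding bform_def
    by (simp add: power2_eq_square algebra_simps sum.distrib sum_subtractf sum_distrib_left)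
  also have "(\<Sum>i\<in>U. \<Sum>j\<in>U. K i j * (s j)\<^sup>2) = (\<Sum>j\<in>U. \<Sum>i\<in>U. K i j * (s j)\<^sup>2)"
    by (rule sum.swap)
  also have "\<dots> = N s"
    unfolding N_def \<pi>_def sum_distrib_right using sym by (intro sum.cong refl) auto
  also have "(\<Sum>i\<in>U. \<Sum>j\<in>U. K i j * (s i)\<^sup>2) = N s"
    unfolding N_def \<pi>_def sum_distrib_right by simp
  finally have dir: "(\<Sum>i\<in>U. \<Sum>j\<in>U. K i j * (s i - s j)\<^sup>2) \<le> 0"
    using Ns lam1 by (simp add: lam_def)
  have const: "s i = s h" if "i \<in> U" for i
  proof -
    have "K i h * (s i - s h)\<^sup>2 \<le> (\<Sum>j\<in>U. K i j * (s i - s j)\<^sup>2)"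
      using fin hub that nonneg by (intro member_le_sum) auto
    also have "\<dots> \<le> (\<Sum>i\<in>U. \<Sum>j\<in>U. K i j * (s i - s j)\<^sup>2)"
      using fin that nonneg
      by (intro member_le_sum[of i U "\<lambda>i. \<Sum>j\<in>U. K i j * (s i - s j)\<^sup>2"] sum_nonneg) auto
    finally have "K i h * (s i - s h)\<^sup>2 \<le> 0" using dir by simp
    then show ?thesis using hub(2)[OF that] by (simp add: mult_le_0_iff)
  qed
  have "(\<Sum>i\<in>U. \<pi> i * s i) = (\<Sum>i\<in>U. \<pi> i) * s h"
    unfolding sum_distrib_right using const by (intro sum.cong refl) auto
  moreover have "(\<Sum>i\<in>U. \<pi> i) > 0" using fin hub \<pi> by (intro sum_pos) auto
  ultimately have "s h = 0" using smean by simp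
  then have "N s = 0" unfolding N_def using const by simp
  then show False using Ns by simp
qed

section \<open>The local-to-global step\<close>

text \<open>Here \<open>c\<close> is a symmetric 3-tensor and \<open>H\<close> its contraction with
  \<open>x\<close>. Reverse Cauchy for each slice \<open>c i\<close>, applied to \<open>x\<close>
  and \<open>z\<close>, bounds \<open>H\<close> by the square of the Markov operator with kernel
  \<open>x i * H i j * x j\<close>; the hub index provides irreducibility.\<close>

lemma hyperbolic_positive_combination:
  fixes c :: "'b \<Rightarrow> 'b \<Rightarrow> 'b \<Rightarrow> real" and x :: "'b \<Rightarrow> real" and V :: "'b set"
  defines "H \<equiv> \<lambda>j k. \<Sum>i\<in>V. x i * c i j k"
  assumes fin: "finite V" and x: "\<And>i. i \<in> V \<Longrightarrow> x i > 0"
    and nonneg: "\<And>i j k. i \<in> V \<Longrightarrow> j \<in> V \<Longrightarrow> k \<in> V \<Longrightarrow> c i j k \<ge> 0"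
    and sym: "\<And>i j k. i \<in> V \<Longrightarrow> j \<in> V \<Longrightarrow> k \<in> V \<Longrightarrow> c i j k = c j i k"
      "\<And>i j k. i \<in> V \<Longrightarrow> j \<in> V \<Longrightarrow> k \<in> V \<Longrightarrow> c i j k = c i k j"
    and hyp: "\<And>i. i \<in> V \<Longrightarrow> hyperbolic V (c i)"
    and hub: "h \<in> V" "\<And>i j. i \<in> V \<Longrightarrow> j \<in> V \<Longrightarrow> H i j > 0 \<Longrightarrow> H i h > 0"
  shows "hyperbolic V H"
proof -
  have Hsym: "H i j = H j i" if "i \<in> V" "j \<in> V" for i j
    unfolding H_def using sym(2) that by (intro sum.cong refl) auto
  have Hnn: "H i j \<ge> 0" if "i \<in> V" "j \<in> V" for i j
    unfolding H_def using nonneg x that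
    by (intro sum_nonneg mult_nonneg_nonneg) (auto intro: less_imp_le)
  \<comment> \<open>The witnessing functional is \<open>H x\<close>. After the substitution
    \<open>z i = x i * t i\<close>, its kernel becomes the mean-zero condition on
    \<open>t\<close>.\<close>
  define l where "l i = (\<Sum>j\<in>V. H i j * x j)" for i
  have lnn: "l i \<ge> 0" if "i \<in> V" for i
    unfolding l_def using Hnn x that
    by (intro sum_nonneg mult_nonneg_nonneg) (auto intro: less_imp_le)
  have Hx: "(\<Sum>j\<in>V. c i j k * x j) = H i k" if "i \<in> V" "k \<in> V" for i k
    unfolding H_def using sym that by (intro sum.cong refl) (auto simp: mult.commute)
  have cx: "(\<Sum>k\<in>V. c i j k * x k) = H i j" if "i \<in> V" "j \<in> V" for i j
    unfolding H_def using sym that by (intro sum.cong refl) (auto simp: mult.commute)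
  have c_xx: "bform V (c i) x x = l i" if "i \<in> V" for i
    unfolding bform_row l_def using cx that by (intro sum.cong refl) (auto simp: mult.commute)
  have c_xz: "bform V (c i) x z = (\<Sum>j\<in>V. H i j * z j)" if "i \<in> V" for i z
  proof -
    have "bform V (c i) x z = bform V (c i) z x" using sym(2) that by (intro bform_commute) auto
    also have "\<dots> = (\<Sum>j\<in>V. H i j * z j)"
      unfolding bform_row using cx that by (intro sum.cong refl) (auto simp: mult.commute)
    finally show ?thesis .
  qed
  \<comment> \<open>Off \<open>U\<close> the row of \<open>H\<close> and the whole slice
    \<open>c i\<close> vanish. On \<open>U\<close> the row sums \<open>x i * l i\<close> of the
    kernel are positive, so they may be divided by.\<close>
  define U where "U = {i \<in> V. l i > 0}"
  have UV: "U \<subseteq> V" and finU: "finite U" using fin by (auto simp: U_def)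
  have l0: "l i = 0" if "i \<in> V - U" for i using that lnn[of i] by (auto simp: U_def)
  have H0: "H i j = 0" if "i \<in> V - U" "j \<in> V" for i j
  proof -
    have "H i j * x j = 0"
      using l0[OF that(1)] that fin Hnn x unfolding l_def
      by (subst (asm) sum_nonneg_eq_0_iff) (auto intro!: mult_nonneg_nonneg less_imp_le[OF x])
    then show ?thesis using x[OF that(2)] by simp
  qed
  have c0: "c i j k = 0" if "i \<in> V - U" "j \<in> V" "k \<in> V" for i j k
  proof -
    have "(\<Sum>k\<in>V. c i j k * x k) = 0" using cx H0 that by auto
    then have "c i j k * x k = 0"
      using that fin nonneg
      by (subst (asm) sum_nonneg_eq_0_iff) (auto intro!: mult_nonneg_nonneg less_imp_le[OF x])
    then show ?thesis using x[OF that(3)] by simp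
  qed
  have "bform V H z z \<le> 0" if mean0: "(\<Sum>i\<in>V. l i * z i) = 0" for z
  proof (cases "U = {}")
    case True
    then have "H i j = 0" if "i \<in> V" "j \<in> V" for i j using H0 that by auto
    then show ?thesis by (simp add: bform_def)
  next
    case False
    then obtain u where u: "u \<in> U" by auto
    have UH: "H i h > 0" if "i \<in> U" for i
    proof -
      have "(\<Sum>j\<in>V. H i j * x j) > 0" using that by (auto simp: U_def l_def)
      then have "\<exists>j\<in>V. H i j * x j \<noteq> 0"
        using sum.neutral[of V "\<lambda>j. H i j * x j"] by force
      then obtain j where "j \<in> V" "H i j * x j \<noteq> 0" by blast
      then have "H i j > 0" using Hnn[of i j] that UV by (auto simp: order_less_le)
      then show ?thesis using hub(2) \<open>j \<in> V\<close> that UV by auto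
    qed
    have hU: "h \<in> U"
    proof (rule ccontr)
      assume "h \<notin> U"
      then have "H h u = 0" using H0 hub(1) u UV by auto
      then show False using UH[OF u] Hsym[of h u] hub(1) u UV by auto
    qed
    define K where "K i j = x i * H i j * x j" for i j
    define t where "t i = z i / x i" for i
    have zt: "z i = x i * t i" if "i \<in> V" for i using x[OF that] by (simp add: t_def)
    have restrict: "(\<Sum>j\<in>V. H i j * y j) = (\<Sum>j\<in>U. H i j * y j)" if "i \<in> V" for i y
      using fin UV H0 Hsym that by (intro sum.mono_neutral_right) auto
    have rowK: "(\<Sum>j\<in>U. K i j) = x i * l i" if "i \<in> U" for i
    proof -
      have "i \<in> V" using that UV by auto
      then show ?thesis unfolding l_def K_def restrict[OF \<open>i \<in> V\<close>]
        by (simp add: sum_distrib_left mult.assoc)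
    qed
    have rowKt: "(\<Sum>j\<in>U. K i j * w j) = x i * (\<Sum>j\<in>V. H i j * (x j * w j))" if "i \<in> U" for i w
    proof -
      have "i \<in> V" using that UV by auto
      then show ?thesis unfolding K_def restrict[OF \<open>i \<in> V\<close>]
        by (simp add: sum_distrib_left mult.assoc)
    qed
    have HK: "bform V H (\<lambda>i. x i * w i) (\<lambda>i. x i * w i) = bform U K w w" for w
    proof -
      have "bform V H (\<lambda>i. x i * w i) (\<lambda>i. x i * w i)
          = (\<Sum>i\<in>U. x i * w i * (\<Sum>j\<in>V. H i j * (x j * w j)))"
        unfolding bform_row using fin UV H0 by (intro sum.mono_neutral_right) auto
      also have "\<dots> = (\<Sum>i\<in>U. w i * (\<Sum>j\<in>U. K i j * w j))"
      proof (intro sum.cong refl)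
        fix i assume i: "i \<in> U"
        show "x i * w i * (\<Sum>j\<in>V. H i j * (x j * w j)) = w i * (\<Sum>j\<in>U. K i j * w j)"
          unfolding rowKt[OF i] by (simp only: mult_ac)
      qed
      finally show ?thesis unfolding bform_row .
    qed
    have "bform U K t t \<le> 0"
    proof (rule Markov_nonpos_on_mean_zero[OF finU _ _ hU])
      fix i j assume "i \<in> U" "j \<in> U"
      then have "i \<in> V" "j \<in> V" "0 < H i h" using UV UH by auto
      then show "K i j = K j i" "K i j \<ge> 0" "0 < K i h"
        using Hsym[of i j] Hnn[of i j] less_imp_le[OF x] x hub(1) unfolding K_def
        by simp_all
    next
      fix w
      let ?z = "\<lambda>i. x i * w i"
      have "bform U K w w = bform V H ?z ?z" by (rule HK[symmetric])
      also have "\<dots> = (\<Sum>j\<in>V. \<Sum>k\<in>V. \<Sum>i\<in>V. x i * (c i j k * ?z j * ?z k))"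
        unfolding bform_def H_def sum_distrib_right by (simp add: mult_ac)
      also have "\<dots> = (\<Sum>j\<in>V. \<Sum>i\<in>V. \<Sum>k\<in>V. x i * (c i j k * ?z j * ?z k))"
        by (intro sum.cong refl sum.swap)
      also have "\<dots> = (\<Sum>i\<in>V. \<Sum>j\<in>V. \<Sum>k\<in>V. x i * (c i j k * ?z j * ?z k))"
        by (rule sum.swap)
      also have "\<dots> = (\<Sum>i\<in>V. x i * bform V (c i) ?z ?z)"
        unfolding bform_def sum_distrib_left ..
      also have "\<dots> = (\<Sum>i\<in>U. x i * bform V (c i) ?z ?z)"
        using fin UV c0 by (intro sum.mono_neutral_right) (auto simp: bform_def)
      \<comment> \<open>Slice by slice, \<open>c i\<close> takes the value \<open>l i\<close> on
        \<open>(x, x)\<close> and \<open>(H z) i\<close> on \<open>(x, z)\<close>. Reverse Cauchy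
        therefore gives exactly the summand of the square of \<open>P\<close>.\<close>
      also have "\<dots> \<le> (\<Sum>i\<in>U. (\<Sum>j\<in>U. K i j * w j)\<^sup>2 / (\<Sum>j\<in>U. K i j))"
      proof (rule sum_mono)
        fix i assume i: "i \<in> U"
        then have iV: "i \<in> V" and li: "l i > 0" using UV by (auto simp: U_def)
        have "l i * bform V (c i) ?z ?z \<le> (\<Sum>j\<in>V. H i j * ?z j)\<^sup>2"
          using hyperbolic_reverse_Cauchy[OF hyp[OF iV] sym(2)[OF iV], of x ?z] li c_xx[OF iV] c_xz[OF iV]
          by simp
        then have "bform V (c i) ?z ?z \<le> (\<Sum>j\<in>V. H i j * ?z j)\<^sup>2 / l i"
          using li by (simp add: field_simps)
        then have "x i * bform V (c i) ?z ?z \<le> x i * ((\<Sum>j\<in>V. H i j * ?z j)\<^sup>2 / l i)"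
          using x[OF iV] by (intro mult_left_mono) auto
        also have "\<dots> = (\<Sum>j\<in>U. K i j * w j)\<^sup>2 / (\<Sum>j\<in>U. K i j)"
          unfolding rowKt[OF i] rowK[OF i] using x[OF iV] by (simp add: power2_eq_square)
        finally show "x i * bform V (c i) ?z ?z \<le> (\<Sum>j\<in>U. K i j * w j)\<^sup>2 / (\<Sum>j\<in>U. K i j)" .
      qed
      finally show "bform U K w w \<le> (\<Sum>i\<in>U. (\<Sum>j\<in>U. K i j * w j)\<^sup>2 / (\<Sum>j\<in>U. K i j))" .
    next
      have "(\<Sum>i\<in>U. (\<Sum>j\<in>U. K i j) * t i) = (\<Sum>i\<in>U. l i * z i)"
      proof (intro sum.cong refl)
        fix i assume i: "i \<in> U"
        then have "i \<in> V" using UV by auto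
        then show "(\<Sum>j\<in>U. K i j) * t i = l i * z i"
          unfolding rowK[OF i] using zt by simp
      qed
      also have "\<dots> = (\<Sum>i\<in>V. l i * z i)"
        using fin UV l0 by (intro sum.mono_neutral_left) auto
      finally show "(\<Sum>i\<in>U. (\<Sum>j\<in>U. K i j) * t i) = 0" using mean0 by simp
    qed
    moreover have "bform V H z z = bform V H (\<lambda>i. x i * t i) (\<lambda>i. x i * t i)"
      using zt by (intro bform_cong) auto
    ultimately show ?thesis unfolding HK by simp
  qed
  then show ?thesis unfolding hyperbolic_def by blast
qed

section \<open>Polar forms\<close>

text \<open>
  A homogeneous polynomial of degree \<open>d\<close> is represented by its polar form: \<open>c M\<close> is the iterated
  partial derivative of the polynomial along a multiset \<open>M\<close> of \<open>d\<close> variables.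
\<close>
definition contract :: "'b set \<Rightarrow> ('b \<Rightarrow> real) \<Rightarrow> ('b multiset \<Rightarrow> real) \<Rightarrow> 'b multiset \<Rightarrow> real" where
  "contract V v c M = (\<Sum>i\<in>V. v i * c (add_mset i M))"

definition contracts :: "'b set \<Rightarrow> ('b \<Rightarrow> real) list \<Rightarrow> ('b multiset \<Rightarrow> real) \<Rightarrow> 'b multiset \<Rightarrow> real" where
  "contracts V vs c = foldr (contract V) vs c"

lemma contracts_Nil [simp]: "contracts V [] c = c"
  and contracts_Cons: "contracts V (v # vs) c M = (\<Sum>i\<in>V. v i * contracts V vs c (add_mset i M))"
  by (simp_all add: contracts_def contract_def)

lemma contracts_nonneg:
  assumes "\<And>M. c M \<ge> 0" "\<And>v i. v \<in> set vs \<Longrightarrow> i \<in> V \<Longrightarrow> v i \<ge> 0"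
  shows "contracts V vs c M \<ge> 0"
  using assms(2)
  by (induction vs arbitrary: M) (auto simp: contracts_Cons assms(1) intro!: sum_nonneg mult_nonneg_nonneg)

text \<open>Induction on the number of positive vectors. Peeling off \<open>v\<close> writes the
  form as a combination, with weights \<open>v i\<close>, of forms in which \<open>i\<close> has
  joined \<open>T\<close>; this is why \<open>T\<close> is arbitrary. With no vectors left, only
  pure partial derivatives remain.\<close>

lemma contracts_hyperbolic:
  assumes fin: "finite V" and nonneg: "\<And>M. c M \<ge> 0"
    and base: "\<And>T. set_mset T \<subseteq> V \<Longrightarrow> size T + 2 = d \<Longrightarrow> hyperbolic V (\<lambda>i j. c (T + {#i, j#}))"
    and hub: "\<And>T vs. set_mset T \<subseteq> V \<Longrightarrow> vs \<noteq> [] \<Longrightarrow> size T + length vs + 2 = d \<Longrightarrow>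
        (\<And>v i. v \<in> set vs \<Longrightarrow> i \<in> V \<Longrightarrow> v i > 0) \<Longrightarrow>
        \<exists>h\<in>V. \<forall>i\<in>V. \<forall>j\<in>V. contracts V vs c (T + {#i, j#}) > 0 \<longrightarrow> contracts V vs c (T + {#i, h#}) > 0"
    and "set_mset T \<subseteq> V" "size T + length vs + 2 = d"
    and "\<And>v i. v \<in> set vs \<Longrightarrow> i \<in> V \<Longrightarrow> v i > 0"
  shows "hyperbolic V (\<lambda>i j. contracts V vs c (T + {#i, j#}))"
  using assms(5-)
proof (induction vs arbitrary: T)
  case Nil
  then show ?case using base by simp
next
  case (Cons v vs)
  have "\<exists>h\<in>V. \<forall>i\<in>V. \<forall>j\<in>V.
      contracts V (v # vs) c (T + {#i, j#}) > 0 \<longrightarrow> contracts V (v # vs) c (T + {#i, h#}) > 0"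
    using Cons.prems by (intro hub) auto
  then obtain h where h: "h \<in> V" and hub': "\<And>i j. i \<in> V \<Longrightarrow> j \<in> V \<Longrightarrow>
      contracts V (v # vs) c (T + {#i, j#}) > 0 \<Longrightarrow> contracts V (v # vs) c (T + {#i, h#}) > 0"
    by blast
  let ?c = "\<lambda>i j k. contracts V vs c (T + {#i, j, k#})"
  have eq: "contracts V (v # vs) c (T + {#j, k#}) = (\<Sum>i\<in>V. v i * ?c i j k)" for j k
    by (simp add: contracts_Cons)
  have "hyperbolic V (\<lambda>j k. \<Sum>i\<in>V. v i * ?c i j k)"
  proof (rule hyperbolic_positive_combination[OF fin _ _ _ _ _ h])
    show "v i > 0" if "i \<in> V" for i using Cons.prems that by auto
    show "?c i j k \<ge> 0" for i j k
      using Cons.prems by (intro contracts_nonneg nonneg) (auto intro: less_imp_le)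
    show "?c i j k = ?c j i k" "?c i j k = ?c i k j" for i j k
      by (simp_all add: add_mset_commute)
    show "hyperbolic V (?c i)" if "i \<in> V" for i
    proof -
      have eq: "add_mset i T + {#j, k#} = T + {#i, j, k#}" for j k by (simp add: multiset_eq_iff)
      show ?thesis
        using Cons.IH[of "add_mset i T"] Cons.prems that unfolding eq by simp
    qed
    show "(\<Sum>i'\<in>V. v i' * ?c i' i h) > 0"
      if "i \<in> V" "j \<in> V" "(\<Sum>i'\<in>V. v i' * ?c i' i j) > 0" for i j
      using hub'[OF that(1,2)] that(3) unfolding eq by simp
  qed
  then show ?case unfolding eq .
qed

lemma contracts_as_bform:
  "contracts V (y # z # vs) c {#} = bform V (\<lambda>i j. contracts V vs c {#i, j#}) y z"
  unfolding bform_row by (simp add: contracts_Cons add_mset_commute mult_ac)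

lemma tendsto_contracts_shift:
  "((\<lambda>e. contracts V (map (\<lambda>v i. v i + e) vs) c M) \<longlongrightarrow> contracts V vs c M) (at_right 0)"
proof (induction vs arbitrary: M)
  case Nil
  then show ?case by simp
next
  case (Cons v vs)
  have "((\<lambda>e. \<Sum>i\<in>V. (v i + e) * contracts V (map (\<lambda>v i. v i + e) vs) c (add_mset i M))
        \<longlongrightarrow> (\<Sum>i\<in>V. (v i + 0) * contracts V vs c (add_mset i M))) (at_right 0)"
    by (intro tendsto_intros Cons.IH)
  then show ?case by (simp add: contracts_Cons)
qed

text \<open>The Alexandrov--Fenchel inequality for polar forms.\<close>
lemma contracts_log_concave:
  assumes fin: "finite V" and nonneg: "\<And>M. c M \<ge> 0"
    and base: "\<And>T. set_mset T \<subseteq> V \<Longrightarrow> size T + 2 = d \<Longrightarrow> hyperbolic V (\<lambda>i j. c (T + {#i, j#}))"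
    and hub: "\<And>T vs. set_mset T \<subseteq> V \<Longrightarrow> vs \<noteq> [] \<Longrightarrow> size T + length vs + 2 = d \<Longrightarrow>
        (\<And>v i. v \<in> set vs \<Longrightarrow> i \<in> V \<Longrightarrow> v i > 0) \<Longrightarrow>
        \<exists>h\<in>V. \<forall>i\<in>V. \<forall>j\<in>V. contracts V vs c (T + {#i, j#}) > 0 \<longrightarrow> contracts V vs c (T + {#i, h#}) > 0"
    and len: "length vs + 2 = d"
    and vs: "\<And>v i. v \<in> set vs \<Longrightarrow> i \<in> V \<Longrightarrow> v i \<ge> 0"
    and y: "\<And>i. i \<in> V \<Longrightarrow> y i \<ge> 0"
  shows "contracts V (y # y # vs) c {#} * contracts V (z # z # vs) c {#}
    \<le> (contracts V (y # z # vs) c {#})\<^sup>2"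
proof -
  \<comment> \<open>Hyperbolicity is available for strictly positive vectors only, so every vector
    in \<open>vs\<close> is shifted by \<open>e > 0\<close>, and the inequality passes to the
    limit.\<close>
  define B where "B e a b = bform V (\<lambda>i j. contracts V (map (\<lambda>v i. v i + e) vs) c {#i, j#}) a b"
    for e :: real and a b
  have lim: "((\<lambda>e. B e a b) \<longlongrightarrow> contracts V (a # b # vs) c {#}) (at_right 0)" for a b
    unfolding B_def contracts_as_bform unfolding bform_def
    by (intro tendsto_intros tendsto_contracts_shift)
  have "B e y y * B e z z \<le> (B e y z)\<^sup>2" if "e > 0" for e
    unfolding B_def
  proof (rule hyperbolic_reverse_Cauchy)
    let ?vs = "map (\<lambda>v i. v i + e) vs"
    have pos: "v i > 0" if "v \<in> set ?vs" "i \<in> V" for v i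
      using that vs \<open>e > 0\<close> by (auto intro: add_nonneg_pos)
    have "hyperbolic V (\<lambda>i j. contracts V ?vs c ({#} + {#i, j#}))"
      by (rule contracts_hyperbolic[OF fin nonneg]) (fact base, fact hub, use pos len in auto)
    then show "hyperbolic V (\<lambda>i j. contracts V ?vs c {#i, j#})" by simp
    show "contracts V ?vs c {#i, j#} = contracts V ?vs c {#j, i#}" for i j
      by (simp add: add_mset_commute)
    show "0 \<le> bform V (\<lambda>i j. contracts V ?vs c {#i, j#}) y y"
      unfolding bform_def using y less_imp_le[OF pos]
      by (intro sum_nonneg mult_nonneg_nonneg contracts_nonneg nonneg) auto
  qed
  then have "\<forall>\<^sub>F e in at_right 0. B e y y * B e z z \<le> (B e y z)\<^sup>2"
    by (auto simp: eventually_at_right_field intro: exI[of _ 1])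
  then show ?thesis
    by (intro tendsto_le[OF _ tendsto_power[OF lim] tendsto_mult[OF lim lim]]) simp_all
qed

section \<open>Cauchy-Schwarz over equivalence classes\<close>

lemma sum_squared_le_card:
  fixes f :: "'b \<Rightarrow> real"
  shows "(\<Sum>i\<in>I. f i)\<^sup>2 \<le> real (card I) * (\<Sum>i\<in>I. (f i)\<^sup>2)"
  using Cauchy_Schwarz_ineq_sum[of "\<lambda>_. 1" f I] by simp

text \<open>The double sum over related pairs is the sum of the squared class sums. Cauchy-Schwarz
  over the classes applies, and there are at most \<open>card B\<close> of them.\<close>

lemma sum_squared_le_equivalence_form:
  fixes t :: "'b \<Rightarrow> real"
  assumes fin: "finite B"
    and r_refl: "\<And>e. e \<in> B \<Longrightarrow> r e e"
    and r_sym: "\<And>e f. e \<in> B \<Longrightarrow> f \<in> B \<Longrightarrow> r e f \<Longrightarrow> r f e"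
    and r_trans: "\<And>e f g. e \<in> B \<Longrightarrow> f \<in> B \<Longrightarrow> g \<in> B \<Longrightarrow> r e f \<Longrightarrow> r f g \<Longrightarrow> r e g"
  shows "(\<Sum>e\<in>B. t e)\<^sup>2 \<le> real (card B) * (\<Sum>e\<in>B. \<Sum>f\<in>B. if r e f then t e * t f else 0)"
proof -
  define cl where "cl e = {f \<in> B. r e f}" for e
  define S where "S C = (\<Sum>e\<in>C. t e)" for C
  have fib: "{e \<in> B. cl e = C} = C" if C: "C \<in> cl ` B" for C
  proof -
    obtain a where a: "a \<in> B" "C = cl a" using C by auto
    have "cl e = cl a \<longleftrightarrow> r a e" if "e \<in> B" for e
      unfolding cl_def using that a(1) r_refl[of e] r_sym[of a e] r_trans[of a e] r_sym[of e a] r_trans[of e a] by blast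
    then show ?thesis using a by (auto simp: cl_def)
  qed
  have group: "(\<Sum>e\<in>B. g e) = (\<Sum>C\<in>cl ` B. \<Sum>e\<in>C. g e)" for g :: "'b \<Rightarrow> real"
    unfolding sum.image_gen[OF fin, of g cl] by (intro sum.cong refl) (simp_all add: fib)
  have "(\<Sum>e\<in>B. \<Sum>f\<in>B. if r e f then t e * t f else 0) = (\<Sum>e\<in>B. t e * S (cl e))"
    unfolding S_def cl_def sum_distrib_left by (simp add: sum.inter_filter[OF fin])
  also have "\<dots> = (\<Sum>C\<in>cl ` B. (S C)\<^sup>2)"
    unfolding group
  proof (rule sum.cong[OF refl])
    fix C assume C: "C \<in> cl ` B"
    have "(\<Sum>e\<in>C. t e * S (cl e)) = (\<Sum>e\<in>C. t e * S C)"
      using fib[OF C] by (intro sum.cong refl) auto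
    then show "(\<Sum>e\<in>C. t e * S (cl e)) = (S C)\<^sup>2"
      by (simp add: S_def power2_eq_square flip: sum_distrib_right)
  qed
  finally have eq: "(\<Sum>e\<in>B. \<Sum>f\<in>B. if r e f then t e * t f else 0) = (\<Sum>C\<in>cl ` B. (S C)\<^sup>2)" .
  have "(\<Sum>e\<in>B. t e)\<^sup>2 = (\<Sum>C\<in>cl ` B. S C)\<^sup>2" unfolding group S_def ..
  also have "\<dots> \<le> real (card (cl ` B)) * (\<Sum>C\<in>cl ` B. (S C)\<^sup>2)" by (rule sum_squared_le_card)
  also have "\<dots> \<le> real (card B) * (\<Sum>C\<in>cl ` B. (S C)\<^sup>2)"
    using card_image_le[OF fin] by (intro mult_right_mono sum_nonneg) auto
  finally show ?thesis unfolding eq .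
qed

section \<open>Rank functions\<close>

text \<open>Satisfied by the rank function of a matroid and, up to a constant, by that of its dual.\<close>
definition rank_like :: "'a set \<Rightarrow> ('a set \<Rightarrow> nat) \<Rightarrow> bool" where
  "rank_like E \<rho> \<longleftrightarrow>
    (\<forall>A e. A \<subseteq> E \<longrightarrow> e \<in> E - A \<longrightarrow> \<rho> A \<le> \<rho> (insert e A) \<and> \<rho> (insert e A) \<le> \<rho> A + 1) \<and>
    (\<forall>A e f. A \<subseteq> E \<longrightarrow> e \<in> E - A \<longrightarrow> f \<in> E - A \<longrightarrow> e \<noteq> f \<longrightarrow>
      \<rho> A + \<rho> (insert e (insert f A)) \<le> \<rho> (insert e A) + \<rho> (insert f A))"

text \<open>
  After scaling the variables, the quadratic form of a contraction has off-diagonal entries \<open>1 / p\<close>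
  on parallel pairs and 1 otherwise, and parallelism is an equivalence relation.
\<close>
lemma rank_like_quadratic:
  fixes t :: "'a \<Rightarrow> real" and p :: real
  assumes fin: "finite E" and \<rho>: "rank_like E \<rho>" and p: "p \<ge> 1" and A: "A \<subseteq> E"
  defines "a \<equiv> \<lambda>X. p ^ \<rho> X" and "B \<equiv> E - A"
  shows "real (card B) * (a A * (\<Sum>e\<in>B. \<Sum>f\<in>B. if e = f then 0 else a (insert e (insert f A)) * t e * t f))
    \<le> (real (card B) - 1) * (\<Sum>e\<in>B. a (insert e A) * t e)\<^sup>2"
proof -
  have inc: "\<rho> X \<le> \<rho> (insert e X)" "\<rho> (insert e X) \<le> \<rho> X + 1" if "X \<subseteq> E" "e \<in> E - X" for X e
    using \<rho> that unfolding rank_like_def by blast+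
  have submod: "\<rho> X + \<rho> (insert e (insert f X)) \<le> \<rho> (insert e X) + \<rho> (insert f X)"
    if "X \<subseteq> E" "e \<in> E - X" "f \<in> E - X" "e \<noteq> f" for X e f
    using \<rho> that unfolding rank_like_def by blast
  define nl where "nl e \<longleftrightarrow> \<rho> (insert e A) = \<rho> A + 1" for e
  \<comment> \<open>Parallel elements of the contraction by \<open>A\<close>: nonloops that together
    have rank 1. The disjunct \<open>e = f\<close> makes loops related to themselves.\<close>
  define par where "par e f \<longleftrightarrow> e = f \<or> nl e \<and> nl f \<and> \<rho> (insert e (insert f A)) = \<rho> A + 1" for e f
  have par_trans: "par e g" if "e \<in> B" "f \<in> B" "g \<in> B" "par e f" "par f g" for e f g
  proof (cases "e = f \<or> f = g \<or> e = g")
    case True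
    then show ?thesis using that by (auto simp: par_def)
  next
    case False
    then have h: "nl e" "nl f" "nl g" "\<rho> (insert e (insert f A)) = \<rho> A + 1"
      "\<rho> (insert f (insert g A)) = \<rho> A + 1" using that by (auto simp: par_def)
    \<comment> \<open>Submodularity over \<open>insert f A\<close> shows that \<open>e\<close>,
      \<open>f\<close>, \<open>g\<close> together raise the rank by only one.\<close>
    have "\<rho> (insert f A) + \<rho> (insert e (insert g (insert f A)))
        \<le> \<rho> (insert e (insert f A)) + \<rho> (insert g (insert f A))"
      using that A False by (intro submod) (auto simp: B_def)
    then have "\<rho> (insert e (insert g (insert f A))) \<le> \<rho> A + 1"
      using h by (simp add: nl_def insert_commute)
    moreover have "\<rho> (insert e (insert g A)) \<le> \<rho> (insert f (insert e (insert g A)))"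
      using that A False by (intro inc) (auto simp: B_def)
    moreover have "\<rho> (insert g A) \<le> \<rho> (insert e (insert g A))"
      using that A False by (intro inc) (auto simp: B_def)
    ultimately show ?thesis using h by (simp add: par_def nl_def insert_commute)
  qed
  define w where "w e = a (insert e A) * t e" for e
  define S where "S = (\<Sum>e\<in>B. w e)"
  define Q where "Q = (\<Sum>e\<in>B. (w e)\<^sup>2)"
  define R where "R = (\<Sum>e\<in>B. \<Sum>f\<in>B. if par e f then w e * w f else 0)"
  have finB: "finite B" using fin by (simp add: B_def)
  \<comment> \<open>The submodularity defect of a pair over \<open>A\<close> is 1 for parallel pairs
    and 0 for all others.\<close>
  have pair: "a A * a (insert e (insert f A))
      = (if par e f then 1 / p else 1) * (a (insert e A) * a (insert f A))"
    if "e \<in> B" "f \<in> B" "e \<noteq> f" for e f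
  proof -
    have m: "\<rho> A + \<rho> (insert e (insert f A)) \<le> \<rho> (insert e A) + \<rho> (insert f A)"
      using that A by (intro submod) (auto simp: B_def)
    have i: "\<rho> A \<le> \<rho> (insert e A)" "\<rho> (insert e A) \<le> \<rho> A + 1"
      "\<rho> A \<le> \<rho> (insert f A)" "\<rho> (insert f A) \<le> \<rho> A + 1"
      using inc[of A e] inc[of A f] that A by (auto simp: B_def)
    have j: "\<rho> (insert f A) \<le> \<rho> (insert e (insert f A))"
      using that A by (intro inc) (auto simp: B_def)
    have "\<rho> (insert e A) \<le> \<rho> (insert f (insert e A))"
      using that A by (intro inc) (auto simp: B_def)
    then have j': "\<rho> (insert e A) \<le> \<rho> (insert e (insert f A))" by (simp add: insert_commute)
    show ?thesis
    proof (cases "par e f")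
      case True
      then have "\<rho> (insert e A) = \<rho> A + 1" "\<rho> (insert f A) = \<rho> A + 1"
        "\<rho> (insert e (insert f A)) = \<rho> A + 1" using that by (auto simp: par_def nl_def)
      then show ?thesis using True p by (simp add: a_def field_simps)
    next
      case False
      then have "\<rho> A + \<rho> (insert e (insert f A)) = \<rho> (insert e A) + \<rho> (insert f A)"
        using m i j j' that unfolding par_def nl_def by linarith
      then show ?thesis using False by (simp add: a_def flip: power_add)
    qed
  qed
  \<comment> \<open>The full square is corrected on parallel pairs by \<open>1 - 1 / p\<close> and
    on the diagonal by a further \<open>1 / p\<close>, which makes the diagonal vanish.\<close>
  have "a A * (\<Sum>e\<in>B. \<Sum>f\<in>B. if e = f then 0 else a (insert e (insert f A)) * t e * t f)
      = (\<Sum>e\<in>B. \<Sum>f\<in>B. w e * w f - (1 - 1 / p) * (if par e f then w e * w f else 0)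
          - (1 / p) * (if f = e then (w e)\<^sup>2 else 0))"
    unfolding sum_distrib_left
  proof (intro sum.cong refl)
    fix e f assume ef: "e \<in> B" "f \<in> B"
    show "a A * (if e = f then 0 else a (insert e (insert f A)) * t e * t f)
      = w e * w f - (1 - 1 / p) * (if par e f then w e * w f else 0)
          - (1 / p) * (if f = e then (w e)\<^sup>2 else 0)"
    proof (cases "e = f")
      case True
      then show ?thesis by (simp add: par_def power2_eq_square algebra_simps)
    next
      case False
      have "a A * (a (insert e (insert f A)) * t e * t f)
          = (if par e f then 1 / p else 1) * (w e * w f)"
        unfolding w_def using pair[OF ef False] by (simp add: mult_ac)
      then show ?thesis using False by (simp add: algebra_simps)
    qed
  qed
  also have "\<dots> = S\<^sup>2 - (1 - 1 / p) * R - (1 / p) * Q"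
  proof -
    have "S\<^sup>2 = (\<Sum>e\<in>B. \<Sum>f\<in>B. w e * w f)"
      by (simp add: S_def power2_eq_square sum_product)
    moreover have "Q = (\<Sum>e\<in>B. \<Sum>f\<in>B. if f = e then (w e)\<^sup>2 else 0)"
      unfolding Q_def using finB by (intro sum.cong refl) simp
    ultimately show ?thesis
      unfolding R_def by (simp only: sum_subtractf sum_distrib_left)
  qed
  finally have form: "a A * (\<Sum>e\<in>B. \<Sum>f\<in>B. if e = f then 0 else a (insert e (insert f A)) * t e * t f)
      = S\<^sup>2 - (1 - 1 / p) * R - (1 / p) * Q" .
  \<comment> \<open>Equality and parallelism each give a Cauchy-Schwarz bound; the two are combined
    with weights \<open>1 / p\<close> and \<open>1 - 1 / p\<close>.\<close>
  have "S\<^sup>2 \<le> real (card B) * Q" unfolding S_def Q_def by (rule sum_squared_le_card)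
  then have "(1 / p) * S\<^sup>2 \<le> (1 / p) * (real (card B) * Q)" using p by (intro mult_left_mono) auto
  moreover have "S\<^sup>2 \<le> real (card B) * R"
    unfolding S_def R_def
  proof (rule sum_squared_le_equivalence_form[OF finB])
    show "par e e" for e by (simp add: par_def)
    show "par f e" if "par e f" for e f
      using that by (auto simp: par_def insert_commute[of f e])
  qed (fact par_trans)
  then have "(1 - 1 / p) * S\<^sup>2 \<le> (1 - 1 / p) * (real (card B) * R)"
    using p by (intro mult_left_mono) auto
  ultimately have "S\<^sup>2 \<le> real (card B) * ((1 - 1 / p) * R + (1 / p) * Q)"
    by (simp add: algebra_simps)
  then show ?thesis
    unfolding form w_def[symmetric] S_def[symmetric] by (simp add: algebra_simps)
qed

text \<open>
  The polar form of \<open>\<Sum>A\<subseteq>E. a A * x\<^sup>A * w ^ (n - card A)\<close>, where the variable \<open>w\<close> has index \<open>None\<close>.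
\<close>
definition polar :: "nat \<Rightarrow> ('a set \<Rightarrow> real) \<Rightarrow> 'a option multiset \<Rightarrow> real" where
  "polar n a N = (if size N = n \<and> (\<forall>e. count N (Some e) \<le> 1)
    then fact (count N None) * a {e. Some e \<in># N} else 0)"

section \<open>Second-order derivatives of a random cluster polynomial\<close>

lemma size_multiset_option:
  assumes "finite E" "set_mset N \<subseteq> insert None (Some ` E)" "\<forall>e. count N (Some e) \<le> 1"
  shows "size N = count N None + card {e. Some e \<in># N}"
proof -
  have "size N = sum (count N) (insert None (Some ` E))"
    unfolding size_multiset_overloaded_eq using assms(1,2)
    by (intro sum.mono_neutral_left) (auto simp: not_in_iff)
  also have "\<dots> = count N None + (\<Sum>e\<in>E. count N (Some e))"
    using assms(1) by (subst sum.insert) (auto simp: sum.reindex)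
  also have "(\<Sum>e\<in>E. count N (Some e)) = (\<Sum>e\<in>E. if Some e \<in># N then 1 else 0)"
    using assms(3) by (intro sum.cong refl) (metis One_nat_def count_eq_zero_iff le_SucE le_zero_eq)
  also have "\<dots> = card {e. Some e \<in># N}"
  proof -
    have "{e \<in> E. Some e \<in># N} = {e. Some e \<in># N}" using assms(2) by auto
    then show ?thesis using assms(1) by (simp flip: sum.inter_filter)
  qed
  finally show ?thesis .
qed

text \<open>The polynomial is affine in each variable \<open>Some e\<close>, so a repetition in
  \<open>T\<close> gives the zero form. Otherwise the variable \<open>None\<close> is eliminated on
  the kernel of its own row, and what remains is \<open>rank_like_quadratic\<close> for the
  contraction by \<open>A\<close>.\<close>

lemma hyperbolic_polar:
  fixes p :: real
  assumes fin: "finite E" and cardE: "card E = n" and \<rho>: "rank_like E \<rho>" and p: "p \<ge> 1"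
    and T: "set_mset T \<subseteq> insert None (Some ` E)" and sz: "size T + 2 = n"
  defines "W \<equiv> insert None (Some ` E)" and "a \<equiv> \<lambda>X. p ^ \<rho> X"
  shows "hyperbolic W (\<lambda>i j. polar n a (T + {#i, j#}))"
proof (cases "\<forall>e. count T (Some e) \<le> 1")
  case False
  then obtain e where "count T (Some e) > 1" by (auto simp: not_le)
  then have "polar n a (T + {#i, j#}) = 0" for i j
    unfolding polar_def by (auto dest!: spec[of _ e])
  then show ?thesis by (simp add: hyperbolic_def bform_def)
next
  case True
  define A where "A = {e. Some e \<in># T}"
  define B where "B = E - A"
  define m where "m = card B"
  have A: "A \<subseteq> E" "finite A" using T fin by (auto simp: A_def intro: finite_subset)
  have finB: "finite B" using fin by (simp add: B_def)
  have "size T = count T None + card A"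
    using size_multiset_option[OF fin T True] by (simp add: A_def)
  moreover have "m = n - card A" using A cardE by (simp add: m_def B_def card_Diff_subset)
  ultimately have "count T None = m - 2" and m: "m \<ge> 2" using sz by auto
  then obtain k where k: "m = Suc (Suc k)" and cnt: "count T None = k"
    by (metis add_2_eq_Suc le_iff_add add_diff_cancel_left')
  have cT: "count T (Some e) = (if e \<in> A then 1 else 0)" for e
    using True unfolding A_def by (metis One_nat_def count_eq_zero_iff le_SucE le_zero_eq mem_Collect_eq)
  have NN: "polar n a (T + {#None, None#}) = fact m * a A"
    using sz cnt cT by (auto simp: polar_def A_def[symmetric] k simp del: fact_Suc)
  have setS: "{e'. Some e' \<in># T + {#None, Some e#}} = insert e A"
    "{e'. Some e' \<in># T + {#Some e, None#}} = insert e A"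
    "{e'. Some e' \<in># T + {#Some e, Some f#}} = insert e (insert f A)" for e f
    by (auto simp: A_def)
  have NS: "polar n a (T + {#None, Some e#}) = (if e \<in> A then 0 else fact (m - 1) * a (insert e A))"
    "polar n a (T + {#Some e, None#}) = (if e \<in> A then 0 else fact (m - 1) * a (insert e A))" for e
    unfolding polar_def setS using sz cnt cT by (auto simp: k simp del: fact_Suc)
  have SS: "polar n a (T + {#Some e, Some f#})
      = (if e \<in> A \<or> f \<in> A \<or> e = f then 0 else fact (m - 2) * a (insert e (insert f A)))" for e f
    unfolding polar_def setS using sz cnt cT by (auto simp: k simp del: fact_Suc)
  have a0: "a X > 0" for X using p by (simp add: a_def)
  \<comment> \<open>The row of \<open>None\<close> in the form, divided by
    \<open>fact (m - 1)\<close>.\<close>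
  define l where "l i = (case i of None \<Rightarrow> real m * a A | Some e \<Rightarrow> if e \<in> A then 0 else a (insert e A))" for i
  have "bform W (\<lambda>i j. polar n a (T + {#i, j#})) z z \<le> 0" if lz: "(\<Sum>i\<in>W. l i * z i) = 0" for z
  proof -
    define y where "y e = z (Some e)" for e
    define S where "S = (\<Sum>e\<in>B. a (insert e A) * y e)"
    define Q where "Q = (\<Sum>e\<in>B. \<Sum>f\<in>B. if e = f then 0 else a (insert e (insert f A)) * y e * y f)"
    have sumW: "(\<Sum>i\<in>W. g i) = g None + (\<Sum>e\<in>E. g (Some e))" for g :: "'a option \<Rightarrow> real"
      unfolding W_def using fin by (subst sum.insert) (auto simp: sum.reindex)
    have sumB: "(\<Sum>e\<in>E. g e) = (\<Sum>e\<in>B. g e)" if "\<And>e. e \<in> A \<Longrightarrow> g e = 0" for g :: "'a \<Rightarrow> real"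
      unfolding B_def using fin that by (intro sum.mono_neutral_right) auto
    have "(\<Sum>i\<in>W. l i * z i) = real m * a A * z None + S"
      unfolding sumW S_def y_def
      by (subst sumB) (auto simp: l_def B_def intro!: sum.cong)
    then have S: "S = - (real m * a A * z None)" using lz by simp
    have "bform W (\<lambda>i j. polar n a (T + {#i, j#})) z z
      = polar n a (T + {#None, None#}) * z None * z None
        + (\<Sum>f\<in>E. polar n a (T + {#None, Some f#}) * z None * y f)
        + (\<Sum>e\<in>E. polar n a (T + {#Some e, None#}) * y e * z None)
        + (\<Sum>e\<in>E. \<Sum>f\<in>E. polar n a (T + {#Some e, Some f#}) * y e * y f)"
      unfolding bform_def sumW y_def by (simp add: sum.distrib)
    also have "(\<Sum>f\<in>E. polar n a (T + {#None, Some f#}) * z None * y f) = fact (m - 1) * z None * S"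
      unfolding S_def sum_distrib_left NS
      by (subst sumB) (auto simp: B_def intro!: sum.cong)
    also have "(\<Sum>e\<in>E. polar n a (T + {#Some e, None#}) * y e * z None) = fact (m - 1) * z None * S"
      unfolding S_def sum_distrib_left NS
      by (subst sumB) (auto simp: B_def intro!: sum.cong)
    also have "(\<Sum>e\<in>E. \<Sum>f\<in>E. polar n a (T + {#Some e, Some f#}) * y e * y f) = fact (m - 2) * Q"
    proof -
      have "(\<Sum>e\<in>E. \<Sum>f\<in>E. polar n a (T + {#Some e, Some f#}) * y e * y f)
        = (\<Sum>e\<in>B. \<Sum>f\<in>B. polar n a (T + {#Some e, Some f#}) * y e * y f)"
        unfolding SS by (subst sumB, simp) (intro sum.cong refl sumB, simp)
      also have "\<dots> = fact (m - 2) * Q"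
        unfolding Q_def sum_distrib_left SS by (intro sum.cong refl) (auto simp: B_def)
      finally show ?thesis .
    qed
    finally have eq: "bform W (\<lambda>i j. polar n a (T + {#i, j#})) z z
      = fact m * a A * z None * z None + 2 * (fact (m - 1) * z None * S) + fact (m - 2) * Q"
      unfolding NN by simp
    have f: "fact m = real m * ((real m - 1) * fact k)" "fact (m - 1) = (real m - 1) * fact k"
      "fact (m - 2) = fact k" by (simp_all add: k)
    have "bform W (\<lambda>i j. polar n a (T + {#i, j#})) z z
      = fact k * (Q - real m * (real m - 1) * a A * (z None)\<^sup>2)"
      unfolding eq f S by (simp add: power2_eq_square algebra_simps)
    also have "\<dots> \<le> 0"
    proof -
      \<comment> \<open>On the kernel \<open>S\<close> is a multiple of \<open>z None\<close>, so
        the bound on \<open>Q\<close> by \<open>S\<^sup>2\<close> becomes one by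
        \<open>(z None)\<^sup>2\<close>; cancelling \<open>m * a A\<close> leaves the required
        inequality.\<close>
      have "real m * (a A * Q) \<le> (real m - 1) * S\<^sup>2"
        using rank_like_quadratic[OF fin \<rho> p A(1), of y]
        unfolding Q_def S_def m_def B_def a_def .
      also have "\<dots> = real m * (a A * (real m * (real m - 1) * a A * (z None)\<^sup>2))"
        unfolding S by (simp add: power2_eq_square)
      finally have "Q \<le> real m * (real m - 1) * a A * (z None)\<^sup>2"
        using m a0[of A] by simp
      then show ?thesis by (simp add: mult_nonneg_nonpos)
    qed
    finally show ?thesis .
  qed
  then show ?thesis unfolding hyperbolic_def by blast
qed

section \<open>Products in disjoint variables\<close>

lemma hyperbolic_zero:
  assumes "\<And>i j. i \<in> V \<Longrightarrow> j \<in> V \<Longrightarrow> H i j = 0"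
  shows "hyperbolic V H"
  using assms by (simp add: hyperbolic_def bform_def)

lemma hyperbolic_scale:
  assumes "hyperbolic V H" "r \<ge> 0"
  shows "hyperbolic V (\<lambda>i j. H i j * r)"
proof -
  have "bform V (\<lambda>i j. H i j * r) z z = r * bform V H z z" for z
    unfolding bform_def sum_distrib_left by (simp add: mult_ac)
  then show ?thesis
    using assms unfolding hyperbolic_def by (metis mult_nonneg_nonpos)
qed

text \<open>Serves to regard a form in the variables of one factor as a form in all variables; the
  functional is transported along \<open>f\<close> and is zero off its image.\<close>

lemma hyperbolic_extend:
  assumes fin: "finite V" and f: "inj_on f W" "f ` W \<subseteq> V"
    and H0: "\<And>i j. i \<in> V \<Longrightarrow> j \<in> V \<Longrightarrow> i \<notin> f ` W \<or> j \<notin> f ` W \<Longrightarrow> H i j = 0"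
    and hyp: "hyperbolic W (\<lambda>i j. H (f i) (f j))"
  shows "hyperbolic V H"
proof -
  obtain l where l: "\<And>z. (\<Sum>i\<in>W. l i * z i) = 0 \<Longrightarrow> bform W (\<lambda>i j. H (f i) (f j)) z z \<le> 0"
    using hyp unfolding hyperbolic_def by blast
  have reindex: "(\<Sum>i\<in>V. g i) = (\<Sum>i\<in>W. g (f i))" if "\<And>i. i \<in> V - f ` W \<Longrightarrow> g i = 0" for g :: "_ \<Rightarrow> real"
  proof -
    have "(\<Sum>i\<in>V. g i) = (\<Sum>i\<in>f ` W. g i)"
      using fin f(2) that by (intro sum.mono_neutral_right) auto
    also have "\<dots> = (\<Sum>i\<in>W. g (f i))" using sum.reindex[OF f(1)] by simp
    finally show ?thesis .
  qed
  define l' where "l' i = (if i \<in> f ` W then l (inv_into W f i) else 0)" for i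
  have "bform V H z z \<le> 0" if "(\<Sum>i\<in>V. l' i * z i) = 0" for z
  proof -
    have "(\<Sum>i\<in>V. l' i * z i) = (\<Sum>i\<in>W. l i * z (f i))"
      using f(1) by (subst reindex) (auto simp: l'_def intro!: sum.cong)
    moreover have "bform V H z z = bform W (\<lambda>i j. H (f i) (f j)) (\<lambda>i. z (f i)) (\<lambda>i. z (f i))"
    proof -
      have "bform V H z z = (\<Sum>i\<in>W. \<Sum>j\<in>V. H (f i) j * z (f i) * z j)"
        unfolding bform_def using H0 by (intro reindex) auto
      also have "\<dots> = bform W (\<lambda>i j. H (f i) (f j)) (\<lambda>i. z (f i)) (\<lambda>i. z (f i))"
        unfolding bform_def using H0 f(2) by (intro sum.cong[OF refl] reindex) auto
      finally show ?thesis .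
    qed
    ultimately show ?thesis using l[of "\<lambda>i. z (f i)"] that by simp
  qed
  then show ?thesis unfolding hyperbolic_def by blast
qed

text \<open>The form is twice the product of a linear form in the \<open>True\<close> variables and
  one in the \<open>False\<close> variables, so it vanishes on the kernel of either.\<close>

lemma hyperbolic_product_of_linear_forms:
  fixes u :: "bool \<times> 'c \<Rightarrow> real"
  assumes fin: "finite V"
  shows "hyperbolic V (\<lambda>i j. if fst i \<noteq> fst j then u i * u j else 0)"
proof -
  define L where "L s z = (\<Sum>i\<in>V. (if fst i = s then u i else 0) * z i)" for s z
  have "bform V (\<lambda>i j. if fst i \<noteq> fst j then u i * u j else 0) z z = 2 * L True z * L False z" for z
  proof -
    have "(\<Sum>j\<in>V. (if fst i \<noteq> fst j then u i * u j else 0) * z j)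
        = (if fst i = True then u i else 0) * L False z + (if fst i = False then u i else 0) * L True z" for i
      unfolding L_def sum_distrib_left sum.distrib[symmetric]
      by (intro sum.cong[OF refl]) auto
    then have "bform V (\<lambda>i j. if fst i \<noteq> fst j then u i * u j else 0) z z
        = (\<Sum>i\<in>V. (if fst i = True then u i else 0) * z i * L False z
            + (if fst i = False then u i else 0) * z i * L True z)"
      unfolding bform_row by (intro sum.cong[OF refl]) (simp add: algebra_simps)
    also have "\<dots> = L True z * L False z + L False z * L True z"
      unfolding sum.distrib L_def sum_distrib_right ..
    finally show ?thesis by simp
  qed
  then show ?thesis unfolding hyperbolic_def L_def[of True]
    by (intro exI[of _ "\<lambda>i. if fst i = True then u i else 0"]) auto
qed

text \<open>
  Indices \<open>(True, _)\<close> and \<open>(False, _)\<close> are the disjoint variables of the two factors of a product.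
\<close>
definition part :: "bool \<Rightarrow> (bool \<times> 'c) multiset \<Rightarrow> 'c multiset" where
  "part s M = image_mset snd (filter_mset (\<lambda>i. fst i = s) M)"

lemma part_empty [simp]: "part s {#} = {#}"
  and part_add [simp]: "part s (add_mset i M) = (if fst i = s then add_mset (snd i) (part s M) else part s M)"
  and part_union [simp]: "part s (M + N) = part s M + part s N"
  by (simp_all add: part_def)

lemma size_part: "size M = size (part True M) + size (part False M)"
  by (induction M) auto

lemma count_part: "count (part s M) x = count M (s, x)"
  by (induction M) auto

text \<open>Derivatives of a product in disjoint variables factor: each factor receives exactly the
  derivatives in its own variables.\<close>

definition product_polar ::
  "nat \<Rightarrow> ('a set \<Rightarrow> real) \<Rightarrow> ('a set \<Rightarrow> real) \<Rightarrow> (bool \<times> 'a option) multiset \<Rightarrow> real" where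
  "product_polar n a b M = polar n a (part True M) * polar n b (part False M)"

lemma polar_nonneg: "(\<And>X. a X \<ge> 0) \<Longrightarrow> polar n a N \<ge> 0"
  by (simp add: polar_def)

lemma polar_size: "size N \<noteq> n \<Longrightarrow> polar n a N = 0"
  by (simp add: polar_def)

text \<open>After \<open>2 * n - 2\<close> derivatives of a product of two factors of degree
  \<open>n\<close>, either one factor is used up and the other is quadratic, or both are linear, or
  some factor has been differentiated more than \<open>n\<close> times and the result is
  zero.\<close>

lemma hyperbolic_product_polar:
  fixes p :: real
  assumes fin: "finite E" and cardE: "card E = n"
    and \<rho>: "rank_like E \<rho>" and \<sigma>: "rank_like E \<sigma>" and p: "p \<ge> 1"
  defines "V \<equiv> (UNIV :: bool set) \<times> insert None (Some ` E)"
    and "c \<equiv> product_polar n (\<lambda>X. p ^ \<rho> X) (\<lambda>X. p ^ \<sigma> X)"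
  assumes T: "set_mset T \<subseteq> V" and sz: "size T + 2 = 2 * n"
  shows "hyperbolic V (\<lambda>i j. c (T + {#i, j#}))"
proof -
  define W where "W = insert None (Some ` E)"
  define g where "g s = (if s then polar n (\<lambda>X. p ^ \<rho> X) else polar n (\<lambda>X. p ^ \<sigma> X))" for s
  have c: "c M = g s (part s M) * g (\<not> s) (part (\<not> s) M)" for s M
    by (cases s) (simp_all add: c_def g_def product_polar_def)
  have g0: "g s N = 0" if "size N \<noteq> n" for s N using that by (simp add: g_def polar_size)
  have gnn: "g s N \<ge> 0" for s N using p by (simp add: g_def polar_nonneg)
  have finV: "finite V" using fin by (simp add: V_def)
  have V: "V = UNIV \<times> W" by (simp add: V_def W_def)
  have one_side: "hyperbolic V (\<lambda>i j. c (T + {#i, j#}))" if s: "size (part s T) + 2 = n" for s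
  proof (rule hyperbolic_extend[OF finV, of "\<lambda>x. (s, x)" W])
    show "inj_on (\<lambda>x. (s, x)) W" "(\<lambda>x. (s, x)) ` W \<subseteq> V" by (auto simp: inj_on_def V)
    show "c (T + {#i, j#}) = 0" if "i \<in> V" "j \<in> V" "i \<notin> (\<lambda>x. (s, x)) ` W \<or> j \<notin> (\<lambda>x. (s, x)) ` W" for i j
    proof -
      have "fst i \<noteq> s \<or> fst j \<noteq> s" using that by (auto simp: V image_iff)
      then have "size (part s (T + {#i, j#})) \<noteq> n" using s by auto
      then show ?thesis using g0 unfolding c[of _ s] by simp
    qed
    have "hyperbolic W (\<lambda>x y. g s (part s T + {#x, y#}))"
    proof -
      have "set_mset (part s T) \<subseteq> insert None (Some ` E)" using T by (auto simp: part_def V_def)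
      then show ?thesis
        using hyperbolic_polar[OF fin cardE \<rho> p _ s] hyperbolic_polar[OF fin cardE \<sigma> p _ s]
        unfolding g_def W_def by (cases s) auto
    qed
    then have "hyperbolic W (\<lambda>x y. g s (part s T + {#x, y#}) * g (\<not> s) (part (\<not> s) T))"
      using gnn by (intro hyperbolic_scale)
    then show "hyperbolic W (\<lambda>x y. c (T + {#(s, x), (s, y)#}))" unfolding c[of _ s] by simp
  qed
  consider "size (part True T) + 2 = n" | "size (part False T) + 2 = n"
    | "size (part True T) + 1 = n" "size (part False T) + 1 = n"
    | "size (part True T) > n \<or> size (part False T) > n"
    using size_part[of T] sz by linarith
  then show ?thesis
  proof cases
    case 1
    then show ?thesis by (rule one_side)
  next
    case 2
    then show ?thesis by (rule one_side)
  next
    case 3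
    have "c (T + {#i, j#}) = (if fst i \<noteq> fst j
        then g (fst i) (part (fst i) T + {#snd i#}) * g (fst j) (part (fst j) T + {#snd j#}) else 0)" for i j
    proof (cases "fst i = fst j")
      case True
      then have "size (part (fst i) (T + {#i, j#})) \<noteq> n" using 3 by (cases "fst i") auto
      then show ?thesis using True g0 unfolding c[of _ "fst i"] by simp
    next
      case False
      then have "fst j = (\<not> fst i)" by auto
      then show ?thesis unfolding c[of _ "fst i"] by simp
    qed
    then show ?thesis
      using hyperbolic_product_of_linear_forms[OF finV, of "\<lambda>i. g (fst i) (part (fst i) T + {#snd i#})"]
      by simp
  next
    case 4
    then have "c (T + {#i, j#}) = 0" for i j
    proof
      assume "size (part True T) > n"
      then have "size (part True (T + {#i, j#})) \<noteq> n" by simp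
      then show ?thesis using g0 unfolding c[of _ True] by simp
    next
      assume "size (part False T) > n"
      then have "size (part False (T + {#i, j#})) \<noteq> n" by simp
      then show ?thesis using g0 unfolding c[of _ True] by simp
    qed
    then show ?thesis by (intro hyperbolic_zero)
  qed
qed

section \<open>Positivity pattern of the contractions\<close>

text \<open>When all coefficients are positive, these are the multisets of variables that divide
  some monomial of \<open>f * g\<close>.\<close>

definition extendable :: "nat \<Rightarrow> (bool \<times> 'a option) multiset \<Rightarrow> bool" where
  "extendable n M \<longleftrightarrow> (\<forall>s. size (part s M) \<le> n \<and> (\<forall>e. count M (s, Some e) \<le> 1))"

text \<open>Any extendable multiset can be completed by the two variables \<open>(s, None)\<close>.\<close>
lemma contracts_product_polar_pos_iff:
  assumes fin: "finite V" and None: "\<And>s. (s, None) \<in> V"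
    and pos: "\<And>X. a X > 0" "\<And>X. b X > 0"
    and vs: "\<And>v i. v \<in> set vs \<Longrightarrow> i \<in> V \<Longrightarrow> v i > 0"
    and sz: "size M + length vs = 2 * n"
  shows "contracts V vs (product_polar n a b) M > 0 \<longleftrightarrow> extendable n M"
  using vs sz
proof (induction vs arbitrary: M)
  case Nil
  have iff: "product_polar n a b M > 0 \<longleftrightarrow> polar n a (part True M) > 0 \<and> polar n b (part False M) > 0"
    using polar_nonneg[of a n "part True M", OF less_imp_le[OF pos(1)]]
      polar_nonneg[of b n "part False M", OF less_imp_le[OF pos(2)]]
    by (auto simp: product_polar_def zero_less_mult_iff)
  have "polar n a N > 0 \<longleftrightarrow> size N = n \<and> (\<forall>e. count N (Some e) \<le> 1)"
    "polar n b N > 0 \<longleftrightarrow> size N = n \<and> (\<forall>e. count N (Some e) \<le> 1)" for N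
    using pos by (auto simp: polar_def)
  moreover have "(\<forall>s. size (part s M) \<le> n) \<longleftrightarrow> size (part True M) = n \<and> size (part False M) = n"
    using Nil size_part[of M] by (auto simp: all_bool_eq)
  ultimately show ?case
    using iff by (auto simp: extendable_def count_part all_bool_eq)
next
  case (Cons v vs)
  have IH: "contracts V vs (product_polar n a b) (add_mset i M) > 0 \<longleftrightarrow> extendable n (add_mset i M)" for i
    using Cons.prems by (intro Cons.IH) auto
  have nn: "contracts V vs (product_polar n a b) N \<ge> 0" for N
    using Cons.prems(1) pos
    by (intro contracts_nonneg) (auto simp: product_polar_def less_imp_le intro!: mult_nonneg_nonneg polar_nonneg)
  have v: "v i > 0" if "i \<in> V" for i using Cons.prems(1) that by simp
  show ?case
  proof
    assume M: "extendable n M"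
    \<comment> \<open>The remaining vector \<open>v\<close> leaves total degree below
      \<open>2 * n\<close>, so some factor still has room for its variable
      \<open>None\<close>.\<close>
    have "size (part True M) < n \<or> size (part False M) < n"
      using Cons.prems(2) size_part[of M] by auto
    then obtain s where s: "size (part s M) < n" by blast
    have "extendable n (add_mset (s, None) M)"
      using M s by (auto simp: extendable_def)
    then have "v (s, None) * contracts V vs (product_polar n a b) (add_mset (s, None) M) > 0"
      using IH v[OF None] by simp
    then show "contracts V (v # vs) (product_polar n a b) M > 0"
      unfolding contracts_Cons using fin None v nn
      by (intro sum_pos2[of V "(s, None)"]) (auto simp: less_imp_le)
  next
    assume "contracts V (v # vs) (product_polar n a b) M > 0"
    then have "\<exists>i\<in>V. v i * contracts V vs (product_polar n a b) (add_mset i M) > 0"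
      unfolding contracts_Cons by (meson not_less sum_nonpos)
    then obtain i where "i \<in> V" "contracts V vs (product_polar n a b) (add_mset i M) > 0"
      using nn v by (metis less_irrefl mult_zero_right order_le_less)
    then have M: "extendable n (add_mset i M)" using IH by simp
    show "extendable n M"
      unfolding extendable_def
    proof (intro allI conjI)
      fix s e
      have "size (part s (add_mset i M)) \<le> n" using M unfolding extendable_def by blast
      then show "size (part s M) \<le> n" by (auto split: if_splits)
      have "count (add_mset i M) (s, Some e) \<le> 1" using M unfolding extendable_def by blast
      then show "count M (s, Some e) \<le> 1" by (auto split: if_splits)
    qed
  qed
qed

text \<open>The hub is the variable \<open>None\<close> of a factor with at least two derivatives to
  spare: it may be repeated freely, so it can replace any \<open>j\<close>.\<close>

lemma contracts_product_polar_hub: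
  assumes fin: "finite V" and None: "\<And>s. (s, None) \<in> V"
    and pos: "\<And>X. a X > 0" "\<And>X. b X > 0"
    and vs: "\<And>v i. v \<in> set vs \<Longrightarrow> i \<in> V \<Longrightarrow> v i > 0" "vs \<noteq> []"
    and sz: "size T + length vs + 2 = 2 * n"
  shows "\<exists>h\<in>V. \<forall>i\<in>V. \<forall>j\<in>V. contracts V vs (product_polar n a b) (T + {#i, j#}) > 0
    \<longrightarrow> contracts V vs (product_polar n a b) (T + {#i, h#}) > 0"
proof -
  have iff: "contracts V vs (product_polar n a b) (T + {#i, j#}) > 0 \<longleftrightarrow> extendable n (T + {#i, j#})" for i j
    using fin None pos vs(1) sz by (intro contracts_product_polar_pos_iff) auto
  have "length vs \<ge> 1" using vs(2) by (simp add: Suc_le_eq)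
  \<comment> \<open>As \<open>vs\<close> is nonempty, \<open>T\<close> has at most
    \<open>2 * n - 3\<close> elements, so its two parts cannot both exceed
    \<open>n - 2\<close>.\<close>
  then have "size (part True T) + 2 \<le> n \<or> size (part False T) + 2 \<le> n"
    using sz size_part[of T] by linarith
  then obtain s where s: "size (part s T) + 2 \<le> n" by blast
  have "extendable n (T + {#i, (s, None)#})" if "extendable n (T + {#i, j#})" for i j
    unfolding extendable_def
  proof (intro allI conjI)
    fix t e
    have "size (part t (T + {#i, j#})) \<le> n" using that unfolding extendable_def by blast
    then show "size (part t (T + {#i, (s, None)#})) \<le> n" using s by (auto split: if_splits)
    have "count (T + {#i, j#}) (t, Some e) \<le> 1" using that unfolding extendable_def by blast
    then show "count (T + {#i, (s, None)#}) (t, Some e) \<le> 1" by (auto split: if_splits)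
  qed
  then show ?thesis unfolding iff using None[of s] by blast
qed

section \<open>Extraction of the complementary pairs\<close>

lemma contracts_replicate_indicator:
  assumes "finite V" "x \<in> V"
  shows "contracts V (replicate k (indicator {x}) @ vs) c M = contracts V vs c (M + replicate_mset k x)"
proof (induction k arbitrary: M)
  case 0
  then show ?case by simp
next
  case (Suc k)
  have "(\<Sum>i\<in>V. indicator {x} i * g i) = g x" for g :: "_ \<Rightarrow> real"
    using assms by (subst sum.remove[of V x]) (auto simp: indicator_def intro!: sum.neutral)
  then show ?case using Suc by (simp add: contracts_Cons)
qed

text \<open>
  Contracting along \<open>x\<^sub>e + y\<^sub>e\<close> for all \<open>e\<close> extracts the complementary pairs of monomials.
\<close>
lemma contracts_pair_sums:
  assumes fin: "finite V" and "distinct es" and V: "\<And>s e. e \<in> set es \<Longrightarrow> (s, Some e) \<in> V"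
  shows "contracts V (map (\<lambda>e. indicator {(True, Some e), (False, Some e)}) es) c M
    = (\<Sum>A\<in>Pow (set es). c (M + image_mset (\<lambda>e. (True, Some e)) (mset_set A)
        + image_mset (\<lambda>e. (False, Some e)) (mset_set (set es - A))))"
  using assms(2,3)
proof (induction es arbitrary: M)
  case Nil
  then show ?case by simp
next
  case (Cons e es)
  let ?t = "\<lambda>A B. image_mset (\<lambda>e. (True, Some e)) (mset_set A) + image_mset (\<lambda>e. (False, Some e)) (mset_set B)"
  have e: "e \<notin> set es" using Cons.prems by simp
  have fA: "finite A" "e \<notin> A" if "A \<in> Pow (set es)" for A
    using that e by (auto intro: finite_subset)
  have "(\<Sum>i\<in>V. indicator {(True, Some e), (False, Some e)} i * g i)
      = g (True, Some e) + g (False, Some e)" for g :: "_ \<Rightarrow> real"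
    using fin Cons.prems(2)[of e]
    by (subst sum.mono_neutral_right[of V "{(True, Some e), (False, Some e)}"]) (auto simp: indicator_def)
  then have "contracts V (map (\<lambda>e. indicator {(True, Some e), (False, Some e)}) (e # es)) c M
    = (\<Sum>A\<in>Pow (set es). c (add_mset (True, Some e) M + ?t A (set es - A)))
      + (\<Sum>A\<in>Pow (set es). c (add_mset (False, Some e) M + ?t A (set es - A)))"
    using Cons by (simp add: contracts_Cons add.assoc)
  also have "(\<Sum>A\<in>Pow (set es). c (add_mset (True, Some e) M + ?t A (set es - A)))
      = (\<Sum>A\<in>Pow (set es). c (M + ?t (insert e A) (set (e # es) - insert e A)))"
  proof (rule sum.cong[OF refl])
    fix A assume A: "A \<in> Pow (set es)"
    have "set (e # es) - insert e A = set es - A" using e by auto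
    then show "c (add_mset (True, Some e) M + ?t A (set es - A))
        = c (M + ?t (insert e A) (set (e # es) - insert e A))"
      using fA[OF A] by simp
  qed
  also have "\<dots> = (\<Sum>A\<in>insert e ` Pow (set es). c (M + ?t A (set (e # es) - A)))"
    using e by (subst sum.reindex) (auto simp: inj_on_def)
  also have "(\<Sum>A\<in>Pow (set es). c (add_mset (False, Some e) M + ?t A (set es - A)))
      = (\<Sum>A\<in>Pow (set es). c (M + ?t A (set (e # es) - A)))"
  proof (rule sum.cong[OF refl])
    fix A assume A: "A \<in> Pow (set es)"
    have "set (e # es) - A = insert e (set es - A)" using fA[OF A] by auto
    then show "c (add_mset (False, Some e) M + ?t A (set es - A)) = c (M + ?t A (set (e # es) - A))"
      using e by simp
  qed
  also have "(\<Sum>A\<in>insert e ` Pow (set es). c (M + ?t A (set (e # es) - A)))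
      + (\<Sum>A\<in>Pow (set es). c (M + ?t A (set (e # es) - A)))
      = (\<Sum>A\<in>Pow (set (e # es)). c (M + ?t A (set (e # es) - A)))"
    using e unfolding list.set Pow_insert
    by (subst sum.union_disjoint) (auto simp: add.commute)
  finally show ?case by (simp add: add.assoc)
qed

text \<open>Each part must have size \<open>n\<close>, and for both parts this says
  \<open>card A = j\<close>. The factorials come from differentiating the powers of the two
  homogenising variables.\<close>

lemma product_polar_complementary:
  assumes fin: "finite E" and cardE: "card E = n" and A: "A \<subseteq> E" and j: "j \<le> n"
  shows "product_polar n a b (replicate_mset (n - j) (True, None) + replicate_mset j (False, None)
      + image_mset (\<lambda>e. (True, Some e)) (mset_set A) + image_mset (\<lambda>e. (False, Some e)) (mset_set (E - A)))
    = (if card A = j then fact (n - j) * fact j * (a A * b (E - A)) else 0)"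
proof -
  have part_rep: "part s (replicate_mset k i) = (if fst i = s then replicate_mset k (snd i) else {#})"
    for s k and i :: "bool \<times> 'a option"
    by (induction k) auto
  have part_img: "part s (image_mset (\<lambda>e. (s', Some e)) N) = (if s' = s then image_mset Some N else {#})"
    for s s' and N :: "'a multiset"
    by (induction N) auto
  have pol: "polar n h (replicate_mset k None + image_mset Some (mset_set B))
      = (if k + card B = n then fact k * h B else 0)" if "finite B" for h :: "'a set \<Rightarrow> real" and k B
  proof -
    have "image_mset Some (mset_set B) = mset_set (Some ` B)"
      by (rule image_mset_mset_set) simp
    then have "count (image_mset Some (mset_set B)) (Some e) \<le> 1"
      "count (image_mset Some (mset_set B)) None = 0" for e
      by (simp_all add: count_mset_set')
    moreover have "{e. Some e \<in># replicate_mset k None + image_mset Some (mset_set B)} = B"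
      using that by (auto simp: in_replicate_mset)
    ultimately show ?thesis by (auto simp: polar_def)
  qed
  have finA: "finite A" using A fin by (rule finite_subset)
  have cA: "card (E - A) = n - card A" "card A \<le> n"
    using A finA cardE fin by (auto simp: card_Diff_subset card_mono)
  show ?thesis
    unfolding product_polar_def part_union part_rep part_img
    using pol[OF finA, where k = "n - j" and h = a] pol[where B = "E - A" and k = j and h = b] fin j cA
    by auto
qed

text \<open>Alexandrov--Fenchel in the directions of the two variables \<open>None\<close>. The
  factor \<open>fact (n - j) * fact j\<close> is \<open>fact n\<close> divided by the binomial
  coefficient, which yields the normalised inequality.\<close>

theorem rank_like_log_concave:
  fixes p :: real
  assumes fin: "finite E" and cardE: "card E = n"
    and \<rho>: "rank_like E \<rho>" and \<sigma>: "rank_like E \<sigma>" and p: "p \<ge> 1" and k: "k + 2 \<le> n"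
  defines "P \<equiv> \<lambda>j. fact (n - j) * fact j * (\<Sum>A | A \<subseteq> E \<and> card A = j. p ^ \<rho> A * p ^ \<sigma> (E - A))"
  shows "P k * P (k + 2) \<le> (P (k + 1))\<^sup>2"
proof -
  define V where "V = (UNIV :: bool set) \<times> insert None (Some ` E)"
  define c where "c = product_polar n (\<lambda>X. p ^ \<rho> X) (\<lambda>X. p ^ \<sigma> X)"
  obtain es where es: "distinct es" "set es = E" using finite_distinct_list[OF fin] by blast
  define us where "us = map (\<lambda>e. indicator {(True, Some e), (False, Some e)} :: _ \<Rightarrow> real) es"
  define w where "w s = (indicator {(s, None)} :: bool \<times> 'a option \<Rightarrow> real)" for s
  \<comment> \<open>These are \<open>2 * n - 2\<close> vectors. Adding two directions
    \<open>w True\<close>, one of each, or two \<open>w False\<close> gives \<open>P k\<close>,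
    \<open>P (k + 1)\<close> and \<open>P (k + 2)\<close> respectively.\<close>
  define vs where "vs = replicate (n - (k + 2)) (w True) @ replicate k (w False) @ us"
  have finV: "finite V" using fin by (simp add: V_def)
  have None: "(s, None) \<in> V" for s by (simp add: V_def)
  have P: "contracts V us c (replicate_mset (n - j) (True, None) + replicate_mset j (False, None)) = P j"
    if "j \<le> n" for j
  proof -
    have "contracts V us c (replicate_mset (n - j) (True, None) + replicate_mset j (False, None))
      = (\<Sum>A\<in>Pow E. if card A = j then fact (n - j) * fact j * (p ^ \<rho> A * p ^ \<sigma> (E - A)) else 0)"
      unfolding us_def
      by (subst contracts_pair_sums[OF finV es(1)])
         (auto simp: V_def es c_def product_polar_complementary[OF fin cardE _ that] intro!: sum.cong)
    also have "\<dots> = (\<Sum>A | A \<in> Pow E \<and> card A = j. fact (n - j) * fact j * (p ^ \<rho> A * p ^ \<sigma> (E - A)))"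
      using fin by (subst sum.inter_filter) auto
    finally show ?thesis by (simp add: P_def sum_distrib_left)
  qed
  have rep: "contracts V (replicate i (w s) @ ws) c M = contracts V ws c (M + replicate_mset i (s, None))"
    for i s ws M
    unfolding w_def by (rule contracts_replicate_indicator[OF finV None])
  have one: "contracts V (w s # ws) c M = contracts V ws c (add_mset (s, None) M)" for s ws M
    using rep[of 1 s ws M] by simp
  have vs: "contracts V vs c M
      = contracts V us c (M + replicate_mset (n - (k + 2)) (True, None) + replicate_mset k (False, None))" for M
    unfolding vs_def rep by simp
  define d where "d = n - (k + 2)"
  have d: "n = d + k + 2" using k by (simp add: d_def)
  have "contracts V (w True # w True # vs) c {#} * contracts V (w False # w False # vs) c {#}
      \<le> (contracts V (w True # w False # vs) c {#})\<^sup>2"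
  proof (rule contracts_log_concave[where d = "2 * n"])
    show "finite V" by (rule finV)
    show "c M \<ge> 0" for M
      using p by (simp add: c_def product_polar_def polar_nonneg)
    show "hyperbolic V (\<lambda>i j. c (T + {#i, j#}))" if "set_mset T \<subseteq> V" "size T + 2 = 2 * n" for T
      using hyperbolic_product_polar[OF fin cardE \<rho> \<sigma> p] that unfolding V_def c_def by blast
    show "\<exists>h\<in>V. \<forall>i\<in>V. \<forall>j\<in>V. contracts V ws c (T + {#i, j#}) > 0 \<longrightarrow> contracts V ws c (T + {#i, h#}) > 0"
      if "ws \<noteq> []" "size T + length ws + 2 = 2 * n" "\<And>v i. v \<in> set ws \<Longrightarrow> i \<in> V \<Longrightarrow> v i > 0" for T ws
      unfolding c_def using that p by (intro contracts_product_polar_hub[OF finV None]) auto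
    have "length es = n" using distinct_card[OF es(1)] es(2) cardE by simp
    then show "length vs + 2 = 2 * n" using k by (simp add: vs_def us_def)
    show "v i \<ge> 0" if "v \<in> set vs" for v i
      using that by (auto simp: vs_def us_def w_def)
    show "w True i \<ge> 0" for i by (simp add: w_def)
  qed
  moreover have "n - k = Suc (Suc d)" "n - (k + 1) = Suc d" "n - (k + 2) = d" using d by simp_all
  then have "contracts V (w True # w True # vs) c {#} = P k"
    "contracts V (w True # w False # vs) c {#} = P (k + 1)"
    "contracts V (w False # w False # vs) c {#} = P (k + 2)"
    using P[of k] P[of "k + 1"] P[of "k + 2"] k unfolding one vs by simp_all
  ultimately show ?thesis by simp
qed

section \<open>Matroids\<close>

context matroid
begin

definition rank :: "'a set \<Rightarrow> nat" where
  "rank X = Max (card ` {I. indep I \<and> I \<subseteq> X})"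

lemma finite_indep_subsets: "finite {I. indep I \<and> I \<subseteq> X}"
  by (rule finite_subset[of _ "Pow carrier"]) (use carrier_finite indep_subset_carrier in auto)

lemma card_le_rank: "indep I \<Longrightarrow> I \<subseteq> X \<Longrightarrow> card I \<le> rank X"
  unfolding rank_def using finite_indep_subsets by (intro Max_ge) auto

lemma basis_exists: "\<exists>I. indep I \<and> I \<subseteq> X \<and> card I = rank X"
proof -
  have "rank X \<in> card ` {I. indep I \<and> I \<subseteq> X}"
    unfolding rank_def using finite_indep_subsets indep_empty by (intro Max_in) auto
  then show ?thesis by auto
qed

lemma rank_mono: "X \<subseteq> Y \<Longrightarrow> rank X \<le> rank Y"
  using basis_exists[of X] card_le_rank[of _ Y] by (metis order_trans)

lemma rank_insert_le: "rank (insert e X) \<le> rank X + 1"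
proof -
  obtain I where I: "indep I" "I \<subseteq> insert e X" "card I = rank (insert e X)"
    using basis_exists by blast
  have "card (I - {e}) \<le> rank X"
    using I indep_subset by (intro card_le_rank) blast+
  moreover have "card I \<le> card (I - {e}) + 1"
    by (simp add: card_Diff_singleton_if) arith
  ultimately show ?thesis using I by simp
qed

text \<open>If the rank grew, augmentation would extend a basis of \<open>X\<close> by an element of
  \<open>insert e (insert f X)\<close>, and the extension would already lie in
  \<open>insert e X\<close> or in \<open>insert f X\<close>.\<close>

lemma rank_insert_insert:
  assumes "rank (insert e X) = rank X" "rank (insert f X) = rank X"
  shows "rank (insert e (insert f X)) = rank X"
proof (rule ccontr)
  assume "\<not> ?thesis"
  then have gt: "rank X < rank (insert e (insert f X))"
    using rank_mono[of X "insert e (insert f X)"] by (simp add: order_less_le subset_insertI2)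
  obtain I where I: "indep I" "I \<subseteq> X" "card I = rank X" using basis_exists by blast
  obtain J where J: "indep J" "J \<subseteq> insert e (insert f X)" "card J = rank (insert e (insert f X))"
    using basis_exists by blast
  obtain x where x: "x \<in> J - I" "indep (insert x I)" using augment[OF J(1) I(1)] gt I J by auto
  have "finite I" using I indep_subset_carrier carrier_finite finite_subset by blast
  then have card: "card (insert x I) = rank X + 1" using x I by simp
  have "insert x I \<subseteq> insert e X \<or> insert x I \<subseteq> insert f X" using x J I by blast
  then have "card (insert x I) \<le> rank X" using card_le_rank[OF x(2)] assms by metis
  then show False using card by simp
qed

text \<open>Unit increase settles every case except the one where neither \<open>e\<close> nor
  \<open>f\<close> alone raises the rank; that one is \<open>rank_insert_insert\<close>.\<close>

lemma rank_submodular: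
  "rank X + rank (insert e (insert f X)) \<le> rank (insert e X) + rank (insert f X)"
proof -
  have "rank X \<le> rank (insert e X)" "rank X \<le> rank (insert f X)" by (auto intro: rank_mono)
  moreover have "rank (insert e (insert f X)) \<le> rank (insert f X) + 1" by (rule rank_insert_le)
  moreover have "rank (insert e (insert f X)) \<le> rank (insert e X) + 1"
    using rank_insert_le[of f "insert e X"] by (simp add: insert_commute)
  ultimately show ?thesis
    using rank_insert_insert[of e X f] by linarith
qed

lemma rank_le_card: "finite X \<Longrightarrow> rank X \<le> card X"
  using basis_exists[of X] card_mono by metis

lemma rank_eq_card_iff: "finite X \<Longrightarrow> rank X = card X \<longleftrightarrow> indep X"
  using basis_exists[of X] card_subset_eq[of X] card_le_rank[of X X] rank_le_card[of X]
  by (metis order_antisym subset_refl)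

lemma rank_like_rank: "rank_like carrier rank"
  unfolding rank_like_def using rank_mono rank_insert_le rank_submodular by (auto simp: subset_insertI)

text \<open>Up to the additive constant \<open>rank carrier\<close>, this is the rank function of the dual matroid.\<close>
lemma rank_like_corank: "rank_like carrier (\<lambda>B. card B + rank (carrier - B))"
proof -
  have fin: "finite B" if "B \<subseteq> carrier" for B using that carrier_finite by (rule finite_subset)
  have ins: "carrier - B = insert e (carrier - insert e B)" if "e \<in> carrier - B" for B e
    using that by auto
  show ?thesis
    unfolding rank_like_def
  proof (intro conjI allI impI)
    fix B e assume B: "B \<subseteq> carrier" "e \<in> carrier - B"
    have "card (insert e B) = card B + 1" using B fin[OF B(1)] by simp
    moreover have "rank (carrier - B) \<le> rank (carrier - insert e B) + 1"
      using rank_insert_le[of e "carrier - insert e B"] ins[OF B(2)] by simp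
    moreover have "rank (carrier - insert e B) \<le> rank (carrier - B)" by (rule rank_mono) auto
    ultimately show "card B + rank (carrier - B) \<le> card (insert e B) + rank (carrier - insert e B)"
      "card (insert e B) + rank (carrier - insert e B) \<le> card B + rank (carrier - B) + 1"
      by simp_all
  next
    fix B e f assume B: "B \<subseteq> carrier" "e \<in> carrier - B" "f \<in> carrier - B" "e \<noteq> f"
    define C where "C = carrier - insert e (insert f B)"
    have "carrier - B = insert e (insert f C)" "carrier - insert e B = insert f C"
      "carrier - insert f B = insert e C"
      using B by (auto simp: C_def)
    moreover have "card (insert e (insert f B)) = card B + 2" "card (insert e B) = card B + 1"
      "card (insert f B) = card B + 1"
      using fin[OF B(1)] B by simp_all
    ultimately show "card B + rank (carrier - B)
        + (card (insert e (insert f B)) + rank (carrier - insert e (insert f B)))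
      \<le> card (insert e B) + rank (carrier - insert e B) + (card (insert f B) + rank (carrier - insert f B))"
      using rank_submodular[of C e f] by (simp add: C_def[symmetric])
  qed
qed

end

section \<open>Weighted counts and their limit\<close>

text \<open>The exponents in \<open>q\<close> are the rank deficits of \<open>A\<close> in the two
  matroids. Taking the rank of the first matroid and the shifted dual rank of the second, with
  \<open>p = 1 / q\<close>, gives the same sums up to a power of \<open>p\<close>.\<close>

lemma weighted_count_log_concave:
  fixes q :: real and r1 r2 :: "'a set \<Rightarrow> nat"
  assumes M: "matroid E indep1" "matroid E indep2" and cardE: "card E = n" and k: "k + 2 \<le> n"
    and q: "0 < q" "q \<le> 1"
  defines "r1 \<equiv> matroid.rank indep1" and "r2 \<equiv> matroid.rank indep2"
  defines "T \<equiv> \<lambda>j. fact (n - j) * fact j * (\<Sum>A | A \<subseteq> E \<and> card A = j. q ^ ((j - r1 A) + (j - r2 A)))"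
  shows "T k * T (k + 2) \<le> (T (k + 1))\<^sup>2"
proof -
  interpret M1: matroid E indep1 by (rule M)
  interpret M2: matroid E indep2 by (rule M)
  have fin: "finite E" by (rule M1.carrier_finite)
  define p where "p = 1 / q"
  have p: "p \<ge> 1" "p > 0" using q by (simp_all add: p_def)
  have pq: "p ^ (i + j) * q ^ j = p ^ i" for i j
    using q by (simp add: p_def power_add power_divide)
  define P where "P j = fact (n - j) * fact j *
      (\<Sum>A | A \<subseteq> E \<and> card A = j. p ^ r1 A * p ^ (card (E - A) + r2 (E - (E - A))))" for j
  have P: "P j = p ^ (n + j) * T j" if j: "j \<le> n" for j
  proof -
    have "p ^ r1 A * p ^ (card (E - A) + r2 (E - (E - A))) = p ^ (n + j) * q ^ ((j - r1 A) + (j - r2 A))"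
      if A: "A \<subseteq> E" "card A = j" for A
    proof -
      have fA: "finite A" using A(1) fin by (rule finite_subset)
      have r: "r1 A \<le> j" "r2 A \<le> j"
        using M1.rank_le_card[OF fA] M2.rank_le_card[OF fA] A by (simp_all add: r1_def r2_def)
      have c: "card (E - A) = n - j" "E - (E - A) = A"
        using A fA cardE by (auto simp: card_Diff_subset)
      have e: "n + j = (r1 A + (n - j + r2 A)) + ((j - r1 A) + (j - r2 A))" using r j by simp
      show ?thesis unfolding c power_add[symmetric, of p "r1 A"] by (subst e) (rule pq[symmetric])
    qed
    then have "(\<Sum>A | A \<subseteq> E \<and> card A = j. p ^ r1 A * p ^ (card (E - A) + r2 (E - (E - A))))
      = (\<Sum>A | A \<subseteq> E \<and> card A = j. p ^ (n + j) * q ^ ((j - r1 A) + (j - r2 A)))"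
      by (intro sum.cong refl) auto
    then show ?thesis by (simp add: P_def T_def sum_distrib_left mult_ac)
  qed
  have "P k * P (k + 2) \<le> (P (k + 1))\<^sup>2"
    using rank_like_log_concave[OF fin cardE M1.rank_like_rank M2.rank_like_corank p(1) k]
    unfolding P_def r1_def r2_def .
  \<comment> \<open>The factors \<open>p ^ (n + j)\<close> are geometric in \<open>j\<close>, so
    both sides acquire the same positive square.\<close>
  moreover have "P k * P (k + 2) = (p ^ (n + k + 1))\<^sup>2 * (T k * T (k + 2))"
    "(P (k + 1))\<^sup>2 = (p ^ (n + k + 1))\<^sup>2 * (T (k + 1))\<^sup>2"
    using P[of k] P[of "k + 1"] P[of "k + 2"] k by (simp_all add: power2_eq_square)
  ultimately have "(p ^ (n + k + 1))\<^sup>2 * (T k * T (k + 2)) \<le> (p ^ (n + k + 1))\<^sup>2 * (T (k + 1))\<^sup>2"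
    by simp
  moreover have "(p ^ (n + k + 1))\<^sup>2 > 0" using p(2) by simp
  ultimately show ?thesis by (simp only: mult_le_cancel_left_pos)
qed

theorem corollary1:
  fixes E :: "'a set" and indep1 indep2 :: "'a set \<Rightarrow> bool" and n k :: nat
  assumes "matroid E indep1" and "matroid E indep2"
    and "card E = n"
    and "k + 2 \<le> n"
  shows "real (common_indep_count indep1 indep2 k) / real (n choose k)
           * (real (common_indep_count indep1 indep2 (k + 2)) / real (n choose (k + 2)))
           \<le> (real (common_indep_count indep1 indep2 (k + 1)) / real (n choose (k + 1)))\<^sup>2"
proof -
  interpret M1: matroid E indep1 by (rule assms)
  interpret M2: matroid E indep2 by (rule assms)
  have fin: "finite E" by (rule M1.carrier_finite)
  define T where "T j q = fact (n - j) * fact j *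
    (\<Sum>A | A \<subseteq> E \<and> card A = j. q ^ ((j - M1.rank A) + (j - M2.rank A)))" for j and q :: real
  \<comment> \<open>At \<open>q = 0\<close> the convention \<open>0 ^ 0 = 1\<close> keeps exactly
    the sets with no deficit in either matroid, the common independent sets.\<close>
  have T0: "T j 0 = fact n * (real (common_indep_count indep1 indep2 j) / real (n choose j))"
    if "j \<le> n" for j
  proof -
    have "(\<Sum>A | A \<subseteq> E \<and> card A = j. (0::real) ^ ((j - M1.rank A) + (j - M2.rank A)))
        = (\<Sum>A | A \<subseteq> E \<and> card A = j. if indep1 A \<and> indep2 A then 1 else 0)"
    proof (intro sum.cong refl)
      fix A assume "A \<in> {A. A \<subseteq> E \<and> card A = j}"
      then have A: "finite A" "card A = j" using fin by (auto intro: finite_subset)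
      have "(j - M1.rank A) + (j - M2.rank A) = 0 \<longleftrightarrow> indep1 A \<and> indep2 A"
        using M1.rank_le_card[OF A(1)] M2.rank_le_card[OF A(1)]
          M1.rank_eq_card_iff[OF A(1)] M2.rank_eq_card_iff[OF A(1)] A(2) by auto
      then show "(0::real) ^ ((j - M1.rank A) + (j - M2.rank A)) = (if indep1 A \<and> indep2 A then 1 else 0)"
        by (simp only: power_0_left)
    qed
    also have "\<dots> = real (card {A \<in> {A. A \<subseteq> E \<and> card A = j}. indep1 A \<and> indep2 A})"
      using fin by (subst sum.inter_filter[symmetric]) auto
    also have "{A \<in> {A. A \<subseteq> E \<and> card A = j}. indep1 A \<and> indep2 A} = {X. indep1 X \<and> indep2 X \<and> card X = j}"
      using M1.indep_subset_carrier by auto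
    finally show ?thesis
      using that by (simp add: T_def common_indep_count_def binomial_fact)
  qed
  have lim: "(T j \<longlongrightarrow> T j 0) (at_right 0)" for j
    unfolding T_def by (intro tendsto_intros)
  \<comment> \<open>The inequality holds for \<open>0 < q < 1\<close>; each \<open>T j\<close> is a
    polynomial in \<open>q\<close>, so it persists at 0.\<close>
  have "\<forall>\<^sub>F q in at_right 0. T k q * T (k + 2) q \<le> (T (k + 1) q)\<^sup>2"
    unfolding eventually_at_right_field T_def
    using weighted_count_log_concave[OF assms] by (intro exI[of _ 1]) auto
  then have "T k 0 * T (k + 2) 0 \<le> (T (k + 1) 0)\<^sup>2"
    by (intro tendsto_le[OF _ tendsto_power[OF lim] tendsto_mult[OF lim lim]]) simp_all
  then have "(fact n)\<^sup>2 * (real (common_indep_count indep1 indep2 k) / real (n choose k)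
           * (real (common_indep_count indep1 indep2 (k + 2)) / real (n choose (k + 2))))
    \<le> (fact n)\<^sup>2 * (real (common_indep_count indep1 indep2 (k + 1)) / real (n choose (k + 1)))\<^sup>2"
    using assms(4) T0[of k] T0[of "k + 1"] T0[of "k + 2"]
    by (simp only: power_mult_distrib) (simp add: power2_eq_square mult_ac)
  then show ?thesis by (simp only: mult_le_cancel_left_pos[OF zero_less_power[OF fact_gt_zero]])
qed

end
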